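(* Let $\mathcal{M}=(M,g)$ be a pseudo-Riemannian manifold of signature $(p,q)$ and dimension $m=p+q\ge 3$ which is Jacobi--Tsankov. Then $\mathcal{M}$ is nilpotent Osserman. If $p=0$ or if $p=1$, then $\mathcal{M}$ is flat.
   Context: Signature $(p,q)$ means $p$ timelike (negative) and $q$ spacelike (positive) directions. With $\nabla$ the Levi-Civita connection, $\mathcal{R}(x,y):=\nabla_x\nabla_y-\nabla_y\nabla_x-\nabla_{[x,y]}$ is the curvature operator and $\mathcal{J}(x):y\mapsto\mathcal{R}(y,x)x$ is the Jacobi operator. $\mathcal{M}$ is Jacobi--Tsankov if $\mathcal{J}(x)\mathcal{J}(y)=\mathcal{J}(y)\mathcal{J}(x)$ for all tangent vectors $x,y$ at the same (arbitrary) point. $\mathcal{M}$ is Osserman if the eigenvalues of $\mathcal{J}$ are constant on the bundle of unit spacelike vectors and constant on the bundle of unit timelike vectors; it is nilpotent Osserman if in addition $\mathcal{J}(x)$ is nilpotent for every tangent vector $x$ (so that $0$ is the only eigenvalue). Flat means $\mathcal{R}=0$. *)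

theory Defs
  imports
    "HOL-Analysis.Analysis"
    "HOL-Library.Function_Algebras"
    "Jordan_Normal_Form.Char_Poly"
begin

text \<open>
  A manifold is a second countable Hausdorff space, the universe of a type, together with a smooth
  atlas modelled on a Euclidean space. Tangent vectors are derivations at a point, vector fields are
  derivations of the algebra of smooth functions, and the Levi-Civita connection is characterised
  as the torsion-free metric connection. Functions carry the pointwise algebraic structure, so
  tangent spaces are subspaces of a real vector space.
\<close>

instantiation "fun" :: (type, real_vector) real_vector
begin

definition scaleR_fun :: "real \<Rightarrow> ('a \<Rightarrow> 'b) \<Rightarrow> 'a \<Rightarrow> 'b"
  where "scaleR_fun c f = (\<lambda>x. c *\<^sub>R f x)"

instance
  by standard (simp_all add: scaleR_fun_def fun_eq_iff scaleR_add_right scaleR_add_left)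

end


subsection \<open>Smooth manifolds\<close>

text \<open>Intended for open \<open>S\<close> only.\<close>

fun C_k_on :: "nat \<Rightarrow> 'e::euclidean_space set \<Rightarrow> ('e \<Rightarrow> 'f::real_normed_vector) \<Rightarrow> bool"
  where
    "C_k_on 0 S f \<longleftrightarrow> continuous_on S f"
  | "C_k_on (Suc k) S f \<longleftrightarrow>
      (\<forall>x\<in>S. f differentiable (at x)) \<and>
      (\<forall>v. C_k_on k S (\<lambda>x. frechet_derivative f (at x) v))"

definition smooth_on :: "'e::euclidean_space set \<Rightarrow> ('e \<Rightarrow> 'f::real_normed_vector) \<Rightarrow> bool"
  where "smooth_on S f \<longleftrightarrow> (\<forall>k. C_k_on k S f)"

text \<open>A chart is a domain \<open>U\<close> with a map that is relevant on \<open>U\<close> only.\<close>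

type_synonym ('a, 'e) atlas = "('a set \<times> ('a \<Rightarrow> 'e)) set"

definition smooth_atlas ::
    "('a::{t2_space, second_countable_topology}, 'e::euclidean_space) atlas \<Rightarrow> bool"
  where
    "smooth_atlas A \<longleftrightarrow>
      (\<forall>(U, \<phi>)\<in>A. open U \<and> open (\<phi> ` U) \<and> homeomorphism U (\<phi> ` U) \<phi> (inv_into U \<phi>)) \<and>
      (\<Union>(U, \<phi>)\<in>A. U) = UNIV \<and>
      (\<forall>(U, \<phi>)\<in>A. \<forall>(V, \<psi>)\<in>A. smooth_on (\<phi> ` (U \<inter> V)) (\<psi> \<circ> inv_into U \<phi>))"

definition smooth_functions :: "('a, 'e::euclidean_space) atlas \<Rightarrow> ('a \<Rightarrow> real) set"
  where "smooth_functions A = {f. \<forall>(U, \<phi>)\<in>A. smooth_on (\<phi> ` U) (f \<circ> inv_into U \<phi>)}"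


subsection \<open>Tangent vectors and vector fields\<close>

type_synonym 'a tangent = "('a \<Rightarrow> real) \<Rightarrow> real"
type_synonym 'a field = "('a \<Rightarrow> real) \<Rightarrow> 'a \<Rightarrow> real"

text \<open>Derivations are set to \<open>0\<close> on functions that are not smooth, so that equality of derivations
  is equality of their values on smooth functions.\<close>

definition tangent_space :: "('a, 'e::euclidean_space) atlas \<Rightarrow> 'a \<Rightarrow> 'a tangent set"
  where
    "tangent_space A x = {v.
      (\<forall>f\<in>smooth_functions A. \<forall>h\<in>smooth_functions A.
        v (f + h) = v f + v h \<and> v (f * h) = v f * h x + f x * v h) \<and>
      (\<forall>c. \<forall>f\<in>smooth_functions A. v (c *\<^sub>R f) = c * v f) \<and>
      (\<forall>f. f \<notin> smooth_functions A \<longrightarrow> v f = 0)}"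

definition vector_fields :: "('a, 'e::euclidean_space) atlas \<Rightarrow> 'a field set"
  where
    "vector_fields A = {X.
      (\<forall>f\<in>smooth_functions A. X f \<in> smooth_functions A) \<and>
      (\<forall>f\<in>smooth_functions A. \<forall>h\<in>smooth_functions A.
        X (f + h) = X f + X h \<and> X (f * h) = X f * h + f * X h) \<and>
      (\<forall>c. \<forall>f\<in>smooth_functions A. X (c *\<^sub>R f) = c *\<^sub>R X f) \<and>
      (\<forall>f. f \<notin> smooth_functions A \<longrightarrow> X f = 0)}"

definition field_at :: "'a field \<Rightarrow> 'a \<Rightarrow> 'a tangent"
  where "field_at X x = (\<lambda>f. X f x)"

definition mult_field :: "('a \<Rightarrow> real) \<Rightarrow> 'a field \<Rightarrow> 'a field"
  where "mult_field f X = (\<lambda>h. f * X h)"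

definition lie_bracket :: "'a field \<Rightarrow> 'a field \<Rightarrow> 'a field"
  where "lie_bracket X Y = (\<lambda>f. X (Y f) - Y (X f))"


subsection \<open>Pseudo-Riemannian metrics\<close>

type_synonym 'a metric_tensor = "'a \<Rightarrow> 'a tangent \<Rightarrow> 'a tangent \<Rightarrow> real"

definition metric_on_fields :: "'a metric_tensor \<Rightarrow> 'a field \<Rightarrow> 'a field \<Rightarrow> 'a \<Rightarrow> real"
  where "metric_on_fields g X Y = (\<lambda>x. g x (field_at X x) (field_at Y x))"

definition pseudo_riemannian_metric ::
    "('a, 'e::euclidean_space) atlas \<Rightarrow> 'a metric_tensor \<Rightarrow> bool"
  where
    "pseudo_riemannian_metric A g \<longleftrightarrow>
      (\<forall>x. \<forall>u\<in>tangent_space A x. \<forall>v\<in>tangent_space A x.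
        g x u v = g x v u \<and>
        (\<forall>w\<in>tangent_space A x. g x (u + v) w = g x u w + g x v w) \<and>
        (\<forall>c. g x (c *\<^sub>R u) v = c * g x u v)) \<and>
      (\<forall>x. \<forall>u\<in>tangent_space A x. (\<forall>v\<in>tangent_space A x. g x u v = 0) \<longrightarrow> u = 0) \<and>
      (\<forall>X\<in>vector_fields A. \<forall>Y\<in>vector_fields A. metric_on_fields g X Y \<in> smooth_functions A)"

definition indexed_basis :: "'v::real_vector set \<Rightarrow> nat \<Rightarrow> (nat \<Rightarrow> 'v) \<Rightarrow> bool"
  where
    "indexed_basis V n e \<longleftrightarrow>
      inj_on e {..<n} \<and> independent (e ` {..<n}) \<and> span (e ` {..<n}) = V"

text \<open>\<open>p\<close> timelike (negative) and \<open>q\<close> spacelike (positive) directions.\<close>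

definition has_signature ::
    "('a, 'e::euclidean_space) atlas \<Rightarrow> 'a metric_tensor \<Rightarrow> nat \<Rightarrow> nat \<Rightarrow> bool"
  where
    "has_signature A g p q \<longleftrightarrow>
      (\<forall>x. \<exists>e. indexed_basis (tangent_space A x) (p + q) e \<and>
        (\<forall>i<p + q. \<forall>j<p + q.
          g x (e i) (e j) = (if i \<noteq> j then 0 else if i < p then - 1 else 1)))"

definition pseudo_riemannian_manifold ::
    "('a::{t2_space, second_countable_topology}, 'e::euclidean_space) atlas \<Rightarrow>
      'a metric_tensor \<Rightarrow> nat \<Rightarrow> nat \<Rightarrow> bool"
  where
    "pseudo_riemannian_manifold A g p q \<longleftrightarrow>
      smooth_atlas A \<and> DIM('e) = p + q \<and> pseudo_riemannian_metric A g \<and> has_signature A g p q"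


subsection \<open>The Levi-Civita connection and its curvature\<close>

type_synonym 'a connection = "'a field \<Rightarrow> 'a field \<Rightarrow> 'a field"

text \<open>Homogeneity of \<open>D X\<close> over the reals is the Leibniz rule for constant \<open>f\<close>.\<close>

definition affine_connection ::
    "('a, 'e::euclidean_space) atlas \<Rightarrow> 'a connection \<Rightarrow> bool"
  where
    "affine_connection A D \<longleftrightarrow>
      (\<forall>X\<in>vector_fields A. \<forall>Y\<in>vector_fields A.
        D X Y \<in> vector_fields A \<and>
        (\<forall>Z\<in>vector_fields A. D (X + Y) Z = D X Z + D Y Z \<and> D X (Y + Z) = D X Y + D X Z) \<and>
        (\<forall>f\<in>smooth_functions A.
          D (mult_field f X) Y = mult_field f (D X Y) \<and>
          D X (mult_field f Y) = mult_field (X f) Y + mult_field f (D X Y)))"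

text \<open>By the fundamental theorem of pseudo-Riemannian geometry these conditions determine \<open>D\<close>
  uniquely on vector fields.\<close>

definition levi_civita_connection ::
    "('a, 'e::euclidean_space) atlas \<Rightarrow> 'a metric_tensor \<Rightarrow> 'a connection \<Rightarrow> bool"
  where
    "levi_civita_connection A g D \<longleftrightarrow>
      affine_connection A D \<and>
      (\<forall>X\<in>vector_fields A. \<forall>Y\<in>vector_fields A. D X Y - D Y X = lie_bracket X Y) \<and>
      (\<forall>X\<in>vector_fields A. \<forall>Y\<in>vector_fields A. \<forall>Z\<in>vector_fields A.
        X (metric_on_fields g Y Z) =
          metric_on_fields g (D X Y) Z + metric_on_fields g Y (D X Z))"

definition curvature_field :: "'a connection \<Rightarrow> 'a field \<Rightarrow> 'a field \<Rightarrow> 'a field \<Rightarrow> 'a field"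
  where
    "curvature_field D X Y Z = D X (D Y Z) - D Y (D X Z) - D (lie_bracket X Y) Z"

text \<open>The curvature operator \<open>R(u,v)\<close> at a point, obtained by extending tangent vectors to vector
  fields; as curvature is tensorial, the result is independent of the extensions.\<close>

definition curvature ::
    "('a, 'e::euclidean_space) atlas \<Rightarrow> 'a connection \<Rightarrow> 'a \<Rightarrow>
      'a tangent \<Rightarrow> 'a tangent \<Rightarrow> 'a tangent \<Rightarrow> 'a tangent"
  where
    "curvature A D x u v w = (THE r. \<exists>X\<in>vector_fields A. \<exists>Y\<in>vector_fields A. \<exists>Z\<in>vector_fields A.
      field_at X x = u \<and> field_at Y x = v \<and> field_at Z x = w \<and>
      r = field_at (curvature_field D X Y Z) x)"

definition jacobi_operator ::
    "('a, 'e::euclidean_space) atlas \<Rightarrow> 'a connection \<Rightarrow> 'a \<Rightarrow>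
      'a tangent \<Rightarrow> 'a tangent \<Rightarrow> 'a tangent"
  where "jacobi_operator A D x u = (\<lambda>v. curvature A D x v u u)"

definition flat :: "('a, 'e::euclidean_space) atlas \<Rightarrow> 'a connection \<Rightarrow> bool"
  where
    "flat A D \<longleftrightarrow>
      (\<forall>x. \<forall>u\<in>tangent_space A x. \<forall>v\<in>tangent_space A x. \<forall>w\<in>tangent_space A x.
        curvature A D x u v w = 0)"

definition jacobi_tsankov :: "('a, 'e::euclidean_space) atlas \<Rightarrow> 'a connection \<Rightarrow> bool"
  where
    "jacobi_tsankov A D \<longleftrightarrow>
      (\<forall>x. \<forall>u\<in>tangent_space A x. \<forall>v\<in>tangent_space A x. \<forall>w\<in>tangent_space A x.
        jacobi_operator A D x u (jacobi_operator A D x v w) =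
        jacobi_operator A D x v (jacobi_operator A D x u w))"


subsection \<open>The Osserman condition\<close>

definition operator_matrix :: "('v::real_vector \<Rightarrow> 'v) \<Rightarrow> nat \<Rightarrow> (nat \<Rightarrow> 'v) \<Rightarrow> real mat \<Rightarrow> bool"
  where
    "operator_matrix T n e M \<longleftrightarrow>
      M \<in> carrier_mat n n \<and> (\<forall>j<n. T (e j) = (\<Sum>i<n. M $$ (i, j) *\<^sub>R e i))"

text \<open>Similar matrices have the same characteristic polynomial, so any basis may be used.\<close>

definition operator_char_poly :: "'v::real_vector set \<Rightarrow> ('v \<Rightarrow> 'v) \<Rightarrow> real poly"
  where
    "operator_char_poly V T =
      (THE c. \<exists>n e M. indexed_basis V n e \<and> operator_matrix T n e M \<and> c = char_poly M)"

text \<open>The complex eigenvalues of \<open>T\<close> on \<open>V\<close>, repeated according to algebraic multiplicity.\<close>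

definition operator_eigenvalues :: "'v::real_vector set \<Rightarrow> ('v \<Rightarrow> 'v) \<Rightarrow> complex multiset"
  where "operator_eigenvalues V T = proots (map_poly complex_of_real (operator_char_poly V T))"

definition osserman ::
    "('a, 'e::euclidean_space) atlas \<Rightarrow> 'a metric_tensor \<Rightarrow> 'a connection \<Rightarrow> bool"
  where
    "osserman A g D \<longleftrightarrow>
      (\<forall>s\<in>{1, - 1}. \<exists>\<Lambda>. \<forall>x. \<forall>u\<in>tangent_space A x. g x u u = s \<longrightarrow>
        operator_eigenvalues (tangent_space A x) (jacobi_operator A D x u) = \<Lambda>)"

definition nilpotent_on :: "'v::zero set \<Rightarrow> ('v \<Rightarrow> 'v) \<Rightarrow> bool"
  where "nilpotent_on V T \<longleftrightarrow> (\<exists>k. \<forall>v\<in>V. (T ^^ k) v = 0)"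

definition nilpotent_osserman ::
    "('a, 'e::euclidean_space) atlas \<Rightarrow> 'a metric_tensor \<Rightarrow> 'a connection \<Rightarrow> bool"
  where
    "nilpotent_osserman A g D \<longleftrightarrow>
      osserman A g D \<and>
      (\<forall>x. \<forall>u\<in>tangent_space A x. nilpotent_on (tangent_space A x) (jacobi_operator A D x u))"

end

theory Submission
  imports Defs
begin

text \<open>
  Write \<open>J(x) y = R(y, x) x\<close>. Since \<open>J(x) x = 0\<close>, commutation gives
  \<open>J(x) J(y) x = J(y) J(x) x = 0\<close>, and polarising this in \<open>x\<close> at \<open>x = y\<close> yields \<open>J(y)\<^sup>2 = 0\<close>, so that
  all characteristic polynomials are powers of the variable. As \<open>J(x)\<close> is self-adjoint with values
  in the orthogonal complement of \<open>x\<close>, its values are null vectors orthogonal to \<open>x\<close>. These vanish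
  if the metric is definite, and also if the metric is Lorentzian and \<open>x\<close> timelike. Timelike
  vectors form an open set, so \<open>J\<close> vanishes identically, and the Bianchi identity gives \<open>R = 0\<close>.

  Tangent vectors extend to vector fields because bump functions times coordinate fields give
  \<open>DIM('e)\<close> independent tangent vectors, which is the dimension prescribed by the signature.
\<close>

text \<open>Functions and fields are global objects, while the curvature at a point is a definite
  description over all global extensions of its arguments. Nothing can be said about it until
  extensions are known to exist and to give one common value; the first needs bump functions, the
  second the symmetries of the curvature on fields. The characteristic polynomial is likewise a
  definite description, over all bases of all lengths. It is pinned down by computing it in an
  arbitrary basis, where the matrix squares to zero. Vanishing on the open set of timelike vectors
  spreads to all vectors because J(x) y is quadratic in x: along a line starting at a timelike
  vector t it is a polynomial in the line parameter, and it vanishes for all small positive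
  parameters.\<close>

no_notation scalar_prod (infix "\<bullet>" 70)

section \<open>Smooth functions on open sets\<close>

lemma C_k_on_subset: "C_k_on k S f \<Longrightarrow> T \<subseteq> S \<Longrightarrow> C_k_on k T f"
  by (induction k arbitrary: f) (auto intro: continuous_on_subset)

lemma C_k_on_cong:
  assumes "open S" and "\<And>x. x \<in> S \<Longrightarrow> f x = h x"
  shows "C_k_on k S f \<longleftrightarrow> C_k_on k S h"
  using assms(2)
proof (induction k arbitrary: f h)
  case 0
  then show ?case by (simp cong: continuous_on_cong)
next
  case (Suc k)
  have diff: "f differentiable (at x) \<longleftrightarrow> h differentiable (at x)" if "x \<in> S" for x
    using that Suc.prems assms(1) unfolding differentiable_def
    by (metis has_derivative_transform_within_open)
  have fd: "frechet_derivative f (at x) = frechet_derivative h (at x)" if "x \<in> S" for x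
  proof (cases "f differentiable (at x)")
    case True
    with that Suc.prems show ?thesis
      by (intro frechet_derivative_transform_within_open[OF _ assms(1)]) auto
  next
    case False
    \<comment> \<open>Where no derivative exists, \<open>frechet_derivative\<close> chooses from one
      and the same predicate for both functions, so the default values agree too. The induction
      hypothesis asks for agreement on all of \<open>S\<close>, with no differentiability
      known.\<close>
    have "(f has_derivative D) (at x) \<longleftrightarrow> (h has_derivative D) (at x)" for D
      using that Suc.prems assms(1) by (metis has_derivative_transform_within_open)
    then show ?thesis unfolding frechet_derivative_def by simp
  qed
  have "C_k_on k S (\<lambda>x. frechet_derivative f (at x) v)
      \<longleftrightarrow> C_k_on k S (\<lambda>x. frechet_derivative h (at x) v)" for v
    by (rule Suc.IH) (simp add: fd)
  with diff show ?case by simp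
qed

lemma C_k_on_Suc_intro:
  assumes "open S" "\<And>x. x \<in> S \<Longrightarrow> (f has_derivative D x) (at x)"
    and "\<And>v. C_k_on k S (\<lambda>x. D x v)"
  shows "C_k_on (Suc k) S f"
proof -
  have "C_k_on k S (\<lambda>x. frechet_derivative f (at x) v)" for v
    using assms(3)[of v] C_k_on_cong[OF assms(1), of "\<lambda>x. frechet_derivative f (at x) v" "\<lambda>x. D x v"]
      frechet_derivative_at[OF assms(2)] by simp
  with assms(2) show ?thesis by (auto simp: differentiable_def)
qed

lemma C_k_on_SucD:
  assumes "C_k_on (Suc k) S f"
  shows "x \<in> S \<Longrightarrow> (f has_derivative frechet_derivative f (at x)) (at x)"
    and "C_k_on k S (\<lambda>x. frechet_derivative f (at x) v)"
  using assms by (auto simp: frechet_derivative_works)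

lemma C_k_on_Suc_imp: "C_k_on (Suc k) S f \<Longrightarrow> C_k_on k S f"
proof (induction k arbitrary: f)
  case 0
  then show ?case
    by (auto intro!: continuous_at_imp_continuous_on differentiable_imp_continuous_within)
next
  case (Suc k)
  have "C_k_on k S (\<lambda>x. frechet_derivative f (at x) v)" for v
    using Suc.prems by (intro Suc.IH) (subst (asm) C_k_on.simps(2), blast)
  moreover have "\<forall>x\<in>S. f differentiable at x"
    using Suc.prems by (subst (asm) C_k_on.simps(2)) blast
  ultimately show ?case by simp
qed

lemma C_k_on_open_cover:
  assumes "\<And>x. x \<in> S \<Longrightarrow> \<exists>T. open T \<and> x \<in> T \<and> C_k_on k T f"
  shows "C_k_on k S f"
  using assms
proof (induction k arbitrary: f)
  case 0
  have "isCont f x" if "x \<in> S" for x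
    using 0[OF that] by (auto simp: continuous_on_eq_continuous_at)
  then show ?case by (simp add: continuous_at_imp_continuous_on)
next
  case (Suc k)
  have "C_k_on k S (\<lambda>x. frechet_derivative f (at x) v)" for v
    using Suc.prems by (intro Suc.IH) fastforce
  moreover have "f differentiable at x" if "x \<in> S" for x
    using Suc.prems[OF that] by auto
  ultimately show ?case by simp
qed

lemma C_k_on_const: "C_k_on k S (\<lambda>x. c)"
  by (induction k arbitrary: c) auto

lemma C_k_on_add:
  assumes "open S" "C_k_on k S f" "C_k_on k S h"
  shows "C_k_on k S (\<lambda>x. f x + h x)"
  using assms(2,3)
proof (induction k arbitrary: f h)
  case 0
  then show ?case by (simp add: continuous_on_add)
next
  case (Suc k)
  show ?case
    by (rule C_k_on_Suc_intro[OF assms(1)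
          has_derivative_add[OF C_k_on_SucD(1)[OF Suc.prems(1)] C_k_on_SucD(1)[OF Suc.prems(2)]]
          Suc.IH[OF C_k_on_SucD(2)[OF Suc.prems(1)] C_k_on_SucD(2)[OF Suc.prems(2)]]])
qed

lemma C_k_on_mult:
  fixes f h :: "'e::euclidean_space \<Rightarrow> real"
  assumes "open S" "C_k_on k S f" "C_k_on k S h"
  shows "C_k_on k S (\<lambda>x. f x * h x)"
  using assms(2,3)
proof (induction k arbitrary: f h)
  case 0
  then show ?case by (simp add: continuous_on_mult)
next
  case (Suc k)
  note f = Suc.prems(1) and h = Suc.prems(2)
  show ?case
    by (rule C_k_on_Suc_intro[OF assms(1)
          has_derivative_mult[OF C_k_on_SucD(1)[OF f] C_k_on_SucD(1)[OF h]]
          C_k_on_add[OF assms(1) Suc.IH[OF C_k_on_Suc_imp[OF f] C_k_on_SucD(2)[OF h]]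
            Suc.IH[OF C_k_on_SucD(2)[OF f] C_k_on_Suc_imp[OF h]]]])
qed

lemma C_k_on_sum:
  assumes "open S" "\<And>i. i \<in> I \<Longrightarrow> C_k_on k S (f i)"
  shows "C_k_on k S (\<lambda>x. \<Sum>i\<in>I. f i x)"
  using assms(2)
  by (induction I rule: infinite_finite_induct)
    (auto intro: C_k_on_const C_k_on_add[OF assms(1)])

lemma C_k_on_linear:
  assumes "bounded_linear L"
  shows "C_k_on k S L"
proof -
  have "C_k_on k UNIV L"
  proof (cases k)
    case 0
    with assms show ?thesis
      by (auto intro: linear_continuous_on)
  next
    case (Suc n)
    show ?thesis unfolding Suc
      by (rule C_k_on_Suc_intro[OF open_UNIV bounded_linear_imp_has_derivative[OF assms] C_k_on_const])
  qed
  then show ?thesis by (rule C_k_on_subset) simp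
qed

lemma C_k_on_linear_compose:
  assumes "open S" "bounded_linear L" "C_k_on k S f"
  shows "C_k_on k S (\<lambda>x. L (f x))"
  using assms(3)
proof (induction k arbitrary: f)
  case 0
  then show ?case by (auto intro: bounded_linear.continuous_on[OF assms(2)])
next
  case (Suc k)
  show ?case
    by (rule C_k_on_Suc_intro[OF assms(1)
          bounded_linear.has_derivative[OF assms(2) C_k_on_SucD(1)[OF Suc.prems]]
          Suc.IH[OF C_k_on_SucD(2)[OF Suc.prems]]])
qed

text \<open>In the chain rule the direction fed to the derivative of \<open>h\<close> varies with
  \<open>x\<close>, but \<open>C_k_on\<close> controls that derivative along fixed directions only.
  Expanding the direction in \<open>Basis\<close> turns the chain rule into a sum of products to
  which the induction hypothesis applies.\<close>

lemma C_k_on_compose: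
  fixes f :: "'e::euclidean_space \<Rightarrow> 'f::euclidean_space" and h :: "'f \<Rightarrow> real"
  assumes "open S" "open T" "f ` S \<subseteq> T" "C_k_on k S f" "C_k_on k T h"
  shows "C_k_on k S (\<lambda>x. h (f x))"
  using assms(4,5)
proof (induction k arbitrary: h)
  case 0
  then show ?case
    using assms(3) by (auto intro: continuous_on_compose2)
next
  case (Suc k)
  note f = Suc.prems(1) and h = Suc.prems(2)
  let ?D = "\<lambda>x v. \<Sum>b\<in>Basis. (frechet_derivative f (at x) v \<bullet> b) * frechet_derivative h (at (f x)) b"
  have "((\<lambda>x. h (f x)) has_derivative ?D x) (at x)" if "x \<in> S" for x
  proof -
    have fx: "f x \<in> T" using that assms(3) by blast
    note dh = C_k_on_SucD(1)[OF h fx]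
    interpret linear "frechet_derivative h (at (f x))"
      using dh has_derivative_linear by blast
    have "frechet_derivative h (at (f x)) (frechet_derivative f (at x) v) = ?D x v" for v
      by (subst euclidean_representation[of "frechet_derivative f (at x) v", symmetric])
        (simp only: sum scaleR real_scaleR_def)
    then show ?thesis
      using has_derivative_compose[OF C_k_on_SucD(1)[OF f that] dh] by simp
  qed
  moreover have "C_k_on k S (\<lambda>x. ?D x v)" for v
    by (intro C_k_on_sum C_k_on_mult assms(1) Suc.IH
        C_k_on_linear_compose[OF _ bounded_linear_inner_left] C_k_on_SucD(2)[OF f]
        C_k_on_Suc_imp[OF f] C_k_on_SucD(2)[OF h])
  ultimately show ?case by (rule C_k_on_Suc_intro[OF assms(1)])
qed

section \<open>Bump functions built from exp(-1/t)\<close>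

lemma exp_neg_inverse_bound:
  fixes t :: real
  assumes "t > 0"
  shows "exp (- (1 / t)) / t ^ n \<le> fact (n + 2) * t\<^sup>2"
proof -
  have series: "(\<lambda>k. (1 / t) ^ k / fact k) sums exp (1 / t)"
    using exp_converges[of "1 / t"] by (simp only: real_scaleR_def divide_inverse mult.commute)
  define F :: real where "F = fact (n + 2)"
  have "F > 0" by (simp add: F_def)
  \<comment> \<open>One term of the exponential series suffices. Its degree exceeds \<open>n\<close>
    by two, which leaves the factor \<open>t\<^sup>2\<close> after multiplying by
    \<open>t\<^sup>2 * exp (- (1 / t))\<close>.\<close>
  have "(1 / t) ^ (n + 2) / F \<le> (\<Sum>k\<le>n + 2. (1 / t) ^ k / fact k)"
    unfolding F_def using assms by (intro member_le_sum) auto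
  also have "\<dots> \<le> (\<Sum>k. (1 / t) ^ k / fact k)"
    using assms sums_summable[OF series] by (intro sum_le_suminf) auto
  also have "\<dots> = exp (1 / t)"
    using sums_unique[OF series] by simp
  finally have "1 / t ^ (n + 2) \<le> F * exp (1 / t)"
    using \<open>F > 0\<close> by (simp only: power_one_over pos_divide_le_eq mult.commute)
  then have "1 / t ^ (n + 2) * (t\<^sup>2 * exp (- (1 / t))) \<le> F * exp (1 / t) * (t\<^sup>2 * exp (- (1 / t)))"
    by (intro mult_right_mono) auto
  moreover have "1 / t ^ (n + 2) * (t\<^sup>2 * exp (- (1 / t))) = exp (- (1 / t)) / t ^ n"
    using assms by (simp add: power_add power2_eq_square)
  moreover have "F * exp (1 / t) * (t\<^sup>2 * exp (- (1 / t))) = F * t\<^sup>2"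
    by (simp add: exp_minus)
  ultimately show ?thesis
    unfolding F_def by (simp only:)
qed

definition exp_neg_inverse :: "nat \<Rightarrow> real \<Rightarrow> real"
  where "exp_neg_inverse n t = (if t > 0 then exp (- (1 / t)) / t ^ n else 0)"

text \<open>The negative powers of the argument make this family closed under differentiation.\<close>

lemma exp_neg_inverse_deriv:
  "(exp_neg_inverse n has_real_derivative
      exp_neg_inverse (n + 2) t - n * exp_neg_inverse (n + 1) t) (at t)"
proof -
  consider "t > 0" | "t < 0" | "t = 0" by linarith
  then show ?thesis
  proof cases
    case 1
    have "((\<lambda>t. exp (- (1 / t)) / t ^ n) has_real_derivative
        exp_neg_inverse (n + 2) t - n * exp_neg_inverse (n + 1) t) (at t)"
    \<comment> \<open>Differentiating \<open>t ^ n\<close> produces the exponent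
      \<open>n - 1\<close>, which truncates at \<open>n = 0\<close>.\<close>
    proof (cases n)
      case 0
      with 1 show ?thesis
        by (auto intro!: derivative_eq_intros simp: exp_neg_inverse_def field_simps power2_eq_square)
    next
      case (Suc m)
      with 1 show ?thesis
        by (auto intro!: derivative_eq_intros simp: exp_neg_inverse_def field_simps power2_eq_square)
          (cases m; simp)
    qed
    then show ?thesis
      by (rule has_field_derivative_transform_within_open[of _ _ _ "{0<..}"])
        (use 1 in \<open>auto simp: exp_neg_inverse_def\<close>)
  next
    case 2
    have "((\<lambda>t. 0) has_real_derivative
        exp_neg_inverse (n + 2) t - n * exp_neg_inverse (n + 1) t) (at t)"
      using 2 by (simp add: exp_neg_inverse_def)
    then show ?thesis
      by (rule has_field_derivative_transform_within_open[of _ _ _ "{..<0}"])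
        (use 2 in \<open>auto simp: exp_neg_inverse_def\<close>)
  next
    case 3
    \<comment> \<open>Of the quadratic factor in the estimate, one power is spent on the difference
      quotient and the other still tends to 0.\<close>
    have bound: "\<bar>exp_neg_inverse n h / h\<bar> \<le> fact (n + 2) * \<bar>h\<bar>" for h
    proof (cases "h > 0")
      case True
      with exp_neg_inverse_bound[OF True, of n] show ?thesis
        by (simp add: exp_neg_inverse_def divide_le_eq power2_eq_square mult_ac)
    next
      case False
      then have "exp_neg_inverse n h = 0" by (simp add: exp_neg_inverse_def)
      moreover have "0 \<le> fact (n + 2) * \<bar>h\<bar>" by (intro mult_nonneg_nonneg) auto
      ultimately show ?thesis by (simp only: div_0 abs_zero)
    qed
    have "((\<lambda>h. exp_neg_inverse n h / h) \<longlongrightarrow> 0) (at 0)"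
    proof (rule Lim_null_comparison)
      show "\<forall>\<^sub>F h in at 0. norm (exp_neg_inverse n h / h) \<le> fact (n + 2) * \<bar>h\<bar>"
        unfolding real_norm_def by (intro always_eventually allI bound)
      show "((\<lambda>h::real. fact (n + 2) * \<bar>h\<bar>) \<longlongrightarrow> 0) (at 0)"
        by (auto intro!: tendsto_eq_intros)
    qed
    then show ?thesis
      using 3 by (simp add: DERIV_def exp_neg_inverse_def)
  qed
qed

lemma C_k_on_exp_neg_inverse: "C_k_on k UNIV (exp_neg_inverse n)"
proof (induction k arbitrary: n)
  case 0
  show ?case
    using exp_neg_inverse_deriv by (auto intro!: DERIV_continuous_on)
next
  case (Suc k)
  have "C_k_on k UNIV
      (\<lambda>t. (exp_neg_inverse (n + 2) t + (- real n) * exp_neg_inverse (n + 1) t) * v)" for v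
    by (intro C_k_on_mult C_k_on_add C_k_on_const Suc open_UNIV)
  then show ?case
    using exp_neg_inverse_deriv[unfolded has_field_derivative_def]
    by (intro C_k_on_Suc_intro[OF open_UNIV]) auto
qed

text \<open>A plateau around the centre is dispensable: the later pairing of fields with functions
  is evaluated at the centre alone, where it yields the square of \<open>b c\<close>.\<close>

lemma smooth_bump_exists:
  fixes c :: "'e::euclidean_space"
  assumes "r > 0"
  obtains b :: "'e \<Rightarrow> real"
  where "smooth_on UNIV b" "b c \<noteq> 0" "\<And>z. z \<notin> cball c r \<Longrightarrow> b z = 0"
proof
  \<comment> \<open>This is the squared radius minus the squared distance to \<open>c\<close>,
    spelled out as sums and products of coordinates so that the closure rules of
    \<open>C_k_on\<close> match it.\<close>
  let ?s = "\<lambda>z. r\<^sup>2 + (\<Sum>i\<in>Basis. (- 1) * (((z \<bullet> i) + - (c \<bullet> i)) * ((z \<bullet> i) + - (c \<bullet> i))))"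
  have s: "?s z = r\<^sup>2 - (dist c z)\<^sup>2" for z
  proof -
    have "(dist c z)\<^sup>2 = (\<Sum>i\<in>Basis. (z \<bullet> i - c \<bullet> i) * (z \<bullet> i - c \<bullet> i))"
      unfolding dist_norm norm_minus_commute[of c] power2_norm_eq_inner euclidean_inner[of "z - c" "z - c"]
      by (simp only: inner_diff_left)
    then show ?thesis by (simp add: sum_negf)
  qed
  have "C_k_on k UNIV ?s" for k
    by (intro C_k_on_add C_k_on_sum C_k_on_mult C_k_on_const open_UNIV
        C_k_on_linear bounded_linear_inner_left)
  then show "smooth_on UNIV (\<lambda>z. exp_neg_inverse 0 (?s z))"
    unfolding smooth_on_def
    by (auto intro: C_k_on_compose[OF open_UNIV open_UNIV _ _ C_k_on_exp_neg_inverse])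
  show "exp_neg_inverse 0 (?s c) \<noteq> 0"
    using assms unfolding s by (simp add: exp_neg_inverse_def)
  show "exp_neg_inverse 0 (?s z) = 0" if "z \<notin> cball c r" for z
    using that assms power_mono[of r "dist c z" 2] unfolding s
    by (simp add: exp_neg_inverse_def not_less)
qed

section \<open>Vector fields on manifolds\<close>

lemma smooth_atlasD:
  assumes "smooth_atlas A" "(U, \<phi>) \<in> A"
  shows "open U" "open (\<phi> ` U)" "homeomorphism U (\<phi> ` U) \<phi> (inv_into U \<phi>)"
    and "(V, \<psi>) \<in> A \<Longrightarrow> smooth_on (\<phi> ` (U \<inter> V)) (\<psi> \<circ> inv_into U \<phi>)"
proof -
  have charts: "\<forall>(U, \<phi>)\<in>A. open U \<and> open (\<phi> ` U) \<and> homeomorphism U (\<phi> ` U) \<phi> (inv_into U \<phi>)"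
    and transition: "\<forall>(U, \<phi>)\<in>A. \<forall>(V, \<psi>)\<in>A. smooth_on (\<phi> ` (U \<inter> V)) (\<psi> \<circ> inv_into U \<phi>)"
    using assms(1) unfolding smooth_atlas_def by blast+
  show "open U" "open (\<phi> ` U)" "homeomorphism U (\<phi> ` U) \<phi> (inv_into U \<phi>)"
    using bspec[OF charts assms(2)] by simp_all
  show "smooth_on (\<phi> ` (U \<inter> V)) (\<psi> \<circ> inv_into U \<phi>)" if "(V, \<psi>) \<in> A"
    using bspec[OF transition assms(2)] that by auto
qed

lemma chart_inj: "smooth_atlas A \<Longrightarrow> (U, \<phi>) \<in> A \<Longrightarrow> inj_on \<phi> U"
  by (rule inj_on_inverseI[where g = "inv_into U \<phi>"])
    (rule homeomorphism_apply1[OF smooth_atlasD(3)])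

lemma chart_image_open:
  assumes "smooth_atlas A" "(U, \<phi>) \<in> A" "open W"
  shows "open (\<phi> ` (U \<inter> W))"
proof -
  note chart = smooth_atlasD[OF assms(1,2)]
  have "openin (top_of_set U) (U \<inter> W)"
    using assms(3) by (simp add: openin_open_Int)
  then have "openin (top_of_set (\<phi> ` U)) (\<phi> ` (U \<inter> W))"
    by (rule homeomorphism_imp_open_map[OF chart(3)])
  with chart(2) show ?thesis by (simp add: openin_open_eq)
qed

text \<open>Two open sets cover the manifold: \<open>U\<close>, where the function is
  \<open>w\<close> after a transition map, and the complement of the preimage \<open>L\<close> of
  \<open>K\<close>, where it is 0. That complement is open because \<open>L\<close> is compact and
  the space is Hausdorff.\<close>

lemma smooth_functions_extend_by_zero:
  fixes A :: "('a::{t2_space, second_countable_topology}, 'e::euclidean_space) atlas"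
  assumes A: "smooth_atlas A" and U: "(U, \<phi>) \<in> A"
    and w: "smooth_on (\<phi> ` U) w"
    and K: "compact K" "K \<subseteq> \<phi> ` U" "\<And>z. z \<in> \<phi> ` U \<Longrightarrow> z \<notin> K \<Longrightarrow> w z = 0"
  shows "(\<lambda>y. if y \<in> U then w (\<phi> y) else 0) \<in> smooth_functions A"
    (is "?F \<in> _")
proof -
  note chartU = smooth_atlasD[OF A U]
  define L where "L = inv_into U \<phi> ` K"
  have "continuous_on K (inv_into U \<phi>)"
    by (rule continuous_on_subset[OF homeomorphism_cont2[OF chartU(3)] K(2)])
  then have "closed L"
    unfolding L_def using K(1) by (intro compact_imp_closed compact_continuous_image)
  have F0: "?F y = 0" if "y \<notin> L" for y
  proof (cases "y \<in> U")
    case True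
    have "\<phi> y \<notin> K"
    proof
      assume "\<phi> y \<in> K"
      then have "inv_into U \<phi> (\<phi> y) \<in> L" unfolding L_def by (rule imageI)
      with that show False using inv_into_f_f[OF chart_inj[OF A U] True] by simp
    qed
    with True K(3) show ?thesis by simp
  qed simp
  have "C_k_on k (\<psi> ` V) (?F \<circ> inv_into V \<psi>)" if V: "(V, \<psi>) \<in> A" for V \<psi> k
  proof (rule C_k_on_open_cover)
    fix z assume "z \<in> \<psi> ` V"
    then obtain y where y: "y \<in> V" "z = \<psi> y" by blast
    note chartV = smooth_atlasD[OF A V]
    have inv: "inv_into V \<psi> (\<psi> y) = y" if "y \<in> V" for y
      using inv_into_f_f[OF chart_inj[OF A V] that] .
    show "\<exists>T. open T \<and> z \<in> T \<and> C_k_on k T (?F \<circ> inv_into V \<psi>)"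
    proof (cases "y \<in> U")
      case True
      let ?T = "\<psi> ` (V \<inter> U)"
      have T: "open ?T" by (rule chart_image_open[OF A V chartU(1)])
      have "C_k_on k ?T (\<lambda>z. w ((\<phi> \<circ> inv_into V \<psi>) z))"
      proof (rule C_k_on_compose[OF T chartU(2)])
        show "C_k_on k ?T (\<phi> \<circ> inv_into V \<psi>)" and "C_k_on k (\<phi> ` U) w"
          using w chartV(4)[OF U] unfolding smooth_on_def by blast+
      qed (auto simp: inv)
      then have "C_k_on k ?T (?F \<circ> inv_into V \<psi>)"
        by (subst C_k_on_cong[OF T, of _ "\<lambda>z. w ((\<phi> \<circ> inv_into V \<psi>) z)"]) (auto simp: inv)
      with T True y show ?thesis by blast
    next
      case False
      let ?T = "\<psi> ` (V \<inter> - L)"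
      have T: "open ?T"
        by (rule chart_image_open[OF A V]) (use \<open>closed L\<close> in auto)
      have "C_k_on k ?T (?F \<circ> inv_into V \<psi>)"
      proof (subst C_k_on_cong[OF T, of _ "\<lambda>z. 0"])
        fix z' assume "z' \<in> ?T"
        then obtain y' where y': "y' \<in> V" "y' \<notin> L" "z' = \<psi> y'" by blast
        show "(?F \<circ> inv_into V \<psi>) z' = 0"
          unfolding comp_apply y'(3) inv[OF y'(1)] by (rule F0[OF y'(2)])
      qed (rule C_k_on_const)
      moreover have "L \<subseteq> U"
        unfolding L_def using K(2) by (auto intro!: inv_into_into)
      ultimately show ?thesis using T False y by blast
    qed
  qed
  then show ?thesis unfolding smooth_functions_def smooth_on_def by blast
qed

lemma smooth_functions_smooth_on:
  "f \<in> smooth_functions A \<Longrightarrow> (U, \<phi>) \<in> A \<Longrightarrow> smooth_on (\<phi> ` U) (f \<circ> inv_into U \<phi>)"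
  unfolding smooth_functions_def by auto

lemma smooth_functions_add:
  assumes "smooth_atlas A" "f \<in> smooth_functions A" "h \<in> smooth_functions A"
  shows "f + h \<in> smooth_functions A"
  using assms smooth_atlasD(2)[OF assms(1)]
  by (auto simp: smooth_functions_def smooth_on_def comp_def plus_fun_def intro!: C_k_on_add)

lemma smooth_functions_mult:
  assumes "smooth_atlas A" "f \<in> smooth_functions A" "h \<in> smooth_functions A"
  shows "f * h \<in> smooth_functions A"
  using assms smooth_atlasD(2)[OF assms(1)]
  by (auto simp: smooth_functions_def smooth_on_def comp_def times_fun_def intro!: C_k_on_mult)

lemma smooth_functions_const: "(\<lambda>x. c) \<in> smooth_functions A"
  by (auto simp: smooth_functions_def smooth_on_def comp_def C_k_on_const)

lemma smooth_functions_zero: "0 \<in> smooth_functions A"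
  using smooth_functions_const[of 0] by (simp add: zero_fun_def)

lemma smooth_functions_scaleR:
  assumes "smooth_atlas A" "f \<in> smooth_functions A"
  shows "c *\<^sub>R f \<in> smooth_functions A"
  using smooth_functions_mult[OF assms(1) smooth_functions_const[of c] assms(2)]
  by (simp add: times_fun_def scaleR_fun_def)

lemma smooth_functions_diff:
  assumes "smooth_atlas A" "f \<in> smooth_functions A" "h \<in> smooth_functions A"
  shows "f - h \<in> smooth_functions A"
  using smooth_functions_add[OF assms(1,2) smooth_functions_scaleR[OF assms(1,3), of "- 1"]]
  by simp

lemma vector_fieldsD:
  assumes "X \<in> vector_fields A"
  shows "f \<in> smooth_functions A \<Longrightarrow> X f \<in> smooth_functions A"
    and "f \<in> smooth_functions A \<Longrightarrow> h \<in> smooth_functions A \<Longrightarrow> X (f + h) = X f + X h"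
    and "f \<in> smooth_functions A \<Longrightarrow> h \<in> smooth_functions A \<Longrightarrow> X (f * h) = X f * h + f * X h"
    and "f \<in> smooth_functions A \<Longrightarrow> X (c *\<^sub>R f) = c *\<^sub>R X f"
    and "f \<notin> smooth_functions A \<Longrightarrow> X f = 0"
  using assms by (auto simp: vector_fields_def)

lemma vector_field_diff:
  assumes "smooth_atlas A" "X \<in> vector_fields A"
    and "f \<in> smooth_functions A" "h \<in> smooth_functions A"
  shows "X (f - h) = X f - X h"
  using vector_fieldsD(2)[OF assms(2) smooth_functions_diff[OF assms(1,3,4)] assms(4)]
  by (simp add: algebra_simps)

lemma vector_fields_add:
  assumes "smooth_atlas A" "X \<in> vector_fields A" "Y \<in> vector_fields A"
  shows "X + Y \<in> vector_fields A"
  using vector_fieldsD[OF assms(2)] vector_fieldsD[OF assms(3)] smooth_functions_add[OF assms(1)]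
  unfolding vector_fields_def by (simp add: algebra_simps scaleR_add_right)

lemma vector_fields_scaleR:
  assumes "smooth_atlas A" "X \<in> vector_fields A"
  shows "c *\<^sub>R X \<in> vector_fields A"
proof -
  have "(c *\<^sub>R X) f = c *\<^sub>R X f" for f by (simp add: scaleR_fun_def)
  moreover have "c *\<^sub>R (f * h) = (c *\<^sub>R f) * h" "c *\<^sub>R (f * h) = f * (c *\<^sub>R h)"
    for f h :: "'a \<Rightarrow> real"
    by (auto simp: scaleR_fun_def times_fun_def)
  ultimately show ?thesis
    using vector_fieldsD[OF assms(2)] smooth_functions_scaleR[OF assms(1)]
    unfolding vector_fields_def by (simp add: scaleR_add_right)
qed

lemma vector_fields_diff:
  assumes "smooth_atlas A" "X \<in> vector_fields A" "Y \<in> vector_fields A"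
  shows "X - Y \<in> vector_fields A"
  using vector_fields_add[OF assms(1,2) vector_fields_scaleR[OF assms(1,3), of "- 1"]] by simp

lemma vector_fields_zero: "0 \<in> vector_fields A"
  by (simp add: vector_fields_def smooth_functions_zero)

lemma field_at_linear:
  "field_at (X + Y) x = field_at X x + field_at Y x"
  "field_at (X - Y) x = field_at X x - field_at Y x"
  "field_at (c *\<^sub>R X) x = c *\<^sub>R field_at X x"
  "field_at 0 x = 0"
  by (auto simp: field_at_def scaleR_fun_def)

lemma field_at_tangent: "X \<in> vector_fields A \<Longrightarrow> field_at X x \<in> tangent_space A x"
  by (auto simp: vector_fields_def tangent_space_def field_at_def scaleR_fun_def)

lemma subspace_tangent_space: "subspace (tangent_space A x)"
  by (rule subspaceI) (auto simp: tangent_space_def scaleR_fun_def algebra_simps)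

text \<open>This is the constant coordinate field along \<open>v\<close>, cut off by
  \<open>b\<close>. The test on \<open>f\<close> implements the convention that derivations vanish
  on functions that are not smooth.\<close>

definition chart_field ::
    "('a, 'e::euclidean_space) atlas \<Rightarrow> 'a set \<Rightarrow> ('a \<Rightarrow> 'e) \<Rightarrow> ('e \<Rightarrow> real) \<Rightarrow> 'e \<Rightarrow> 'a field"
  where "chart_field A U \<phi> b v f = (\<lambda>y. if f \<in> smooth_functions A \<and> y \<in> U
    then b (\<phi> y) * frechet_derivative (f \<circ> inv_into U \<phi>) (at (\<phi> y)) v else 0)"

text \<open>The derivation laws are the usual rules for derivatives in the chart. The cutoff serves
  closure: multiplied by \<open>b\<close>, the coordinate derivative of a smooth function is
  supported in \<open>K\<close> and extends by zero.\<close>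

lemma chart_field_vector_field:
  fixes A :: "('a::{t2_space, second_countable_topology}, 'e::euclidean_space) atlas"
  assumes A: "smooth_atlas A" and U: "(U, \<phi>) \<in> A"
    and b: "smooth_on UNIV b"
    and K: "compact K" "K \<subseteq> \<phi> ` U" "\<And>z. z \<notin> K \<Longrightarrow> b z = 0"
  shows "chart_field A U \<phi> b v \<in> vector_fields A"
proof -
  note chart = smooth_atlasD[OF A U]
  have diff: "((f \<circ> inv_into U \<phi>) has_derivative
      frechet_derivative (f \<circ> inv_into U \<phi>) (at (\<phi> y))) (at (\<phi> y))"
    if "f \<in> smooth_functions A" "y \<in> U" for f y
    using smooth_functions_smooth_on[OF that(1) U] that(2) unfolding smooth_on_def
    by (auto intro: C_k_on_SucD(1)[of 0])
  have "chart_field A U \<phi> b v f \<in> smooth_functions A" if f: "f \<in> smooth_functions A" for f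
  proof -
    have "C_k_on k (\<phi> ` U) (\<lambda>z. frechet_derivative (f \<circ> inv_into U \<phi>) (at z) v)" for k
      using smooth_functions_smooth_on[OF f U] unfolding smooth_on_def
      by (intro C_k_on_SucD(2)) blast
    moreover have "C_k_on k (\<phi> ` U) b" for k
      using b unfolding smooth_on_def by (blast intro: C_k_on_subset)
    ultimately have "smooth_on (\<phi> ` U) (\<lambda>z. b z * frechet_derivative (f \<circ> inv_into U \<phi>) (at z) v)"
      unfolding smooth_on_def using chart(2) by (intro allI C_k_on_mult)
    from smooth_functions_extend_by_zero[OF A U this K(1,2)] K(3) f
    show ?thesis by (simp add: chart_field_def)
  qed
  moreover have "chart_field A U \<phi> b v (f + h) = chart_field A U \<phi> b v f + chart_field A U \<phi> b v h"
    if f: "f \<in> smooth_functions A" and h: "h \<in> smooth_functions A" for f h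
  proof
    fix y
    have "frechet_derivative ((f + h) \<circ> inv_into U \<phi>) (at (\<phi> y)) v =
        frechet_derivative (f \<circ> inv_into U \<phi>) (at (\<phi> y)) v +
        frechet_derivative (h \<circ> inv_into U \<phi>) (at (\<phi> y)) v" if "y \<in> U"
      using frechet_derivative_at[OF has_derivative_add[OF diff[OF f that] diff[OF h that]]]
      by (simp add: comp_def plus_fun_def fun_eq_iff)
    then show "chart_field A U \<phi> b v (f + h) y = (chart_field A U \<phi> b v f + chart_field A U \<phi> b v h) y"
      using f h smooth_functions_add[OF A f h] by (simp add: chart_field_def distrib_left)
  qed
  moreover have "chart_field A U \<phi> b v (f * h) =
      chart_field A U \<phi> b v f * h + f * chart_field A U \<phi> b v h"
    if f: "f \<in> smooth_functions A" and h: "h \<in> smooth_functions A" for f h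
  proof
    fix y
    have "frechet_derivative ((f * h) \<circ> inv_into U \<phi>) (at (\<phi> y)) v =
        f y * frechet_derivative (h \<circ> inv_into U \<phi>) (at (\<phi> y)) v +
        frechet_derivative (f \<circ> inv_into U \<phi>) (at (\<phi> y)) v * h y" if "y \<in> U"
      using frechet_derivative_at[OF has_derivative_mult[OF diff[OF f that] diff[OF h that]]]
        inv_into_f_f[OF chart_inj[OF A U] that]
      by (simp add: comp_def times_fun_def fun_eq_iff)
    then show "chart_field A U \<phi> b v (f * h) y =
        (chart_field A U \<phi> b v f * h + f * chart_field A U \<phi> b v h) y"
      using f h smooth_functions_mult[OF A f h] by (simp add: chart_field_def algebra_simps)
  qed
  moreover have "chart_field A U \<phi> b v (c *\<^sub>R f) = c *\<^sub>R chart_field A U \<phi> b v f"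
    if f: "f \<in> smooth_functions A" for f c
  proof
    fix y
    have "frechet_derivative ((c *\<^sub>R f) \<circ> inv_into U \<phi>) (at (\<phi> y)) v =
        c * frechet_derivative (f \<circ> inv_into U \<phi>) (at (\<phi> y)) v" if "y \<in> U"
      using frechet_derivative_at[OF has_derivative_scaleR_right[OF diff[OF f that], of c]]
      by (simp add: comp_def scaleR_fun_def fun_eq_iff)
    then show "chart_field A U \<phi> b v (c *\<^sub>R f) y = (c *\<^sub>R chart_field A U \<phi> b v f) y"
      using f smooth_functions_scaleR[OF A f, of c] by (simp add: chart_field_def scaleR_fun_def)
  qed
  moreover have "chart_field A U \<phi> b v f = 0" if "f \<notin> smooth_functions A" for f
    using that by (auto simp: chart_field_def)
  ultimately show ?thesis unfolding vector_fields_def by blast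
qed

section \<open>Every tangent vector is the value of a vector field\<close>

lemma independent_image_dual:
  fixes F :: "'i \<Rightarrow> 'v::real_vector"
  assumes lin: "\<And>j. j \<in> I \<Longrightarrow> linear (\<epsilon> j)"
    and dual: "\<And>i j. i \<in> I \<Longrightarrow> j \<in> I \<Longrightarrow> \<epsilon> j (F i) = (if i = j then d else 0 :: real)"
    and "d \<noteq> 0"
  shows "independent (F ` I)" "inj_on F I"
proof -
  show inj: "inj_on F I"
    by (rule inj_onI) (metis assms(3) dual)
  show "independent (F ` I)"
    unfolding independent_explicit_module
  proof (intro allI impI)
    fix t u v
    assume t: "finite t" "t \<subseteq> F ` I" "(\<Sum>v\<in>t. u v *\<^sub>R v) = 0" "v \<in> t"
    then obtain j where j: "j \<in> I" "v = F j" by blast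
    interpret linear "\<epsilon> j" by (rule lin[OF j(1)])
    \<comment> \<open>The functional dual to \<open>v\<close> isolates its coefficient, up to the
      common diagonal value \<open>d\<close>. In the application \<open>d\<close> is the square of
      the bump at the centre.\<close>
    have "\<epsilon> j w = (if w = v then d else 0)" if "w \<in> t" for w
      using that t(2) j dual inj by (auto simp: inj_on_def)
    then have "0 = (\<Sum>w\<in>t. u w * (if w = v then d else 0))"
      using arg_cong[OF t(3), of "\<epsilon> j"] by (simp add: sum scaleR)
    also have "\<dots> = u v * d" using t(1,4) by (simp add: if_distrib sum.delta cong: if_cong)
    finally show "u v = 0" using \<open>d \<noteq> 0\<close> by simp
  qed
qed

lemma field_at_surj:
  fixes A :: "('a::{t2_space, second_countable_topology}, 'e::euclidean_space) atlas"
  assumes A: "smooth_atlas A" and e: "indexed_basis (tangent_space A x) DIM('e) e"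
    and u: "u \<in> tangent_space A x"
  obtains X where "X \<in> vector_fields A" "field_at X x = u"
proof -
  obtain U \<phi> where U: "(U, \<phi>) \<in> A" and x: "x \<in> U"
    using A unfolding smooth_atlas_def by blast
  note chart = smooth_atlasD[OF A U]
  obtain r where r: "r > 0" "cball (\<phi> x) r \<subseteq> \<phi> ` U"
    using chart(2) x open_contains_cball by blast
  obtain b :: "'e \<Rightarrow> real" where b: "smooth_on UNIV b" "b (\<phi> x) \<noteq> 0"
    "\<And>z. z \<notin> cball (\<phi> x) r \<Longrightarrow> b z = 0"
    using smooth_bump_exists[OF r(1)] by blast
  define E where "E v = chart_field A U \<phi> b v" for v
  have E: "E v \<in> vector_fields A" for v
    unfolding E_def by (rule chart_field_vector_field[OF A U b(1) compact_cball r(2) b(3)])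
  \<comment> \<open>The coordinate is shifted to vanish at \<open>\<phi> x\<close>. In the product
    rule at that point the derivative of \<open>b\<close> then drops out, so that pairing with
    \<open>E i\<close> gives \<open>b (\<phi> x)\<close> squared times the Kronecker delta.\<close>
  define w where "w j z = b z * ((z \<bullet> j) + (- (\<phi> x \<bullet> j)))" for j z
  define F where "F j y = (if y \<in> U then w j (\<phi> y) else 0)" for j y
  have w: "smooth_on UNIV (w j)" for j
    using b(1) unfolding smooth_on_def w_def
    by (intro allI C_k_on_mult C_k_on_add C_k_on_const open_UNIV
        C_k_on_linear[OF bounded_linear_inner_left]) blast
  have F: "F j \<in> smooth_functions A" for j
    unfolding F_def
  proof (rule smooth_functions_extend_by_zero[OF A U _ compact_cball r(2)])
    show "smooth_on (\<phi> ` U) (w j)"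
      using w[of j] unfolding smooth_on_def by (blast intro: C_k_on_subset)
    show "w j z = 0" if "z \<notin> cball (\<phi> x) r" for z
      unfolding w_def b(3)[OF that] by simp
  qed
  have EF: "field_at (E i) x (F j) = b (\<phi> x) * (b (\<phi> x) * (i \<bullet> j))" for i j
  proof -
    have "(b has_derivative frechet_derivative b (at (\<phi> x))) (at (\<phi> x))"
      using b(1) C_k_on_SucD(1)[of 0 UNIV b] unfolding smooth_on_def by blast
    then have "(w j has_derivative (\<lambda>v. b (\<phi> x) * (v \<bullet> j))) (at (\<phi> x))"
      unfolding w_def by (auto intro!: derivative_eq_intros)
    then have "((F j \<circ> inv_into U \<phi>) has_derivative (\<lambda>v. b (\<phi> x) * (v \<bullet> j))) (at (\<phi> x))"
      by (rule has_derivative_transform_within_open[OF _ chart(2)])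
        (use x inv_into_f_f[OF chart_inj[OF A U]] in \<open>auto simp: F_def\<close>)
    from frechet_derivative_at[OF this, symmetric] show ?thesis
      using F x by (simp add: field_at_def E_def chart_field_def)
  qed
  have indep: "independent ((\<lambda>i. field_at (E i) x) ` Basis)" "inj_on (\<lambda>i. field_at (E i) x) Basis"
    by (rule independent_image_dual[of Basis "\<lambda>j v. v (F j)" _ "(b (\<phi> x))\<^sup>2"];
        auto simp: EF inner_Basis power2_eq_square b(2) scaleR_fun_def intro!: linearI)+
  let ?B = "(\<lambda>i. field_at (E i) x) ` Basis"
  have "u \<in> span ?B"
  \<comment> \<open>Otherwise adjoining \<open>u\<close> gives one more than \<open>DIM('e)\<close>
    independent vectors in a space spanned by \<open>DIM('e)\<close> vectors.\<close>
  proof (rule ccontr)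
    assume "u \<notin> span ?B"
    with indep(1) have ind: "independent (insert u ?B)" and "u \<notin> ?B"
      by (auto simp: independent_insert span_base)
    have span: "span (e ` {..<DIM('e)}) = tangent_space A x"
      using e unfolding indexed_basis_def by simp
    have "insert u ?B \<subseteq> span (e ` {..<DIM('e)})"
      unfolding span using u field_at_tangent[OF E] by auto
    then have "card (insert u ?B) \<le> card (e ` {..<DIM('e)})"
      using independent_span_bound[OF _ ind] by blast
    with \<open>u \<notin> ?B\<close> card_image[OF indep(2)] show False
      using card_image_le[of "{..<DIM('e)}" e] by simp
  qed
  moreover have "subspace ((\<lambda>X. field_at X x) ` vector_fields A)"
  proof (rule subspaceI)
    show "0 \<in> (\<lambda>X. field_at X x) ` vector_fields A"
      by (rule image_eqI[of _ _ 0]) (simp_all add: field_at_linear vector_fields_zero)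
  next
    fix u v
    assume "u \<in> (\<lambda>X. field_at X x) ` vector_fields A" "v \<in> (\<lambda>X. field_at X x) ` vector_fields A"
    then obtain X Y where "X \<in> vector_fields A" "Y \<in> vector_fields A"
      "u = field_at X x" "v = field_at Y x" by blast
    then show "u + v \<in> (\<lambda>X. field_at X x) ` vector_fields A"
      by (intro image_eqI[of _ _ "X + Y"]) (simp_all add: field_at_linear vector_fields_add[OF A])
  next
    fix c u assume "u \<in> (\<lambda>X. field_at X x) ` vector_fields A"
    then obtain X where "X \<in> vector_fields A" "u = field_at X x" by blast
    then show "c *\<^sub>R u \<in> (\<lambda>X. field_at X x) ` vector_fields A"
      by (intro image_eqI[of _ _ "c *\<^sub>R X"])
        (simp_all add: field_at_linear vector_fields_scaleR[OF A])
  qed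
  ultimately have "u \<in> (\<lambda>X. field_at X x) ` vector_fields A"
    using E span_minimal[of ?B "(\<lambda>X. field_at X x) ` vector_fields A"] by blast
  with that show ?thesis by blast
qed

section \<open>Algebraic curvature tensors\<close>

text \<open>The octahedron argument: up to sign the four Bianchi identities involve six terms, each
  occurring in exactly two of them. First plus fourth minus second minus third leaves twice the
  difference sought. Values are real and arguments range over an arbitrary set, so that one proof
  serves both vector fields and tangent vectors.\<close>

lemma curvature_pair_symmetry:
  fixes K :: "'v \<Rightarrow> 'v \<Rightarrow> 'v \<Rightarrow> 'v \<Rightarrow> real"
  assumes skew: "\<And>x y z w. x \<in> S \<Longrightarrow> y \<in> S \<Longrightarrow> z \<in> S \<Longrightarrow> w \<in> S \<Longrightarrow> K x y z w = - K y x z w"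
    and skew': "\<And>x y z w. x \<in> S \<Longrightarrow> y \<in> S \<Longrightarrow> z \<in> S \<Longrightarrow> w \<in> S \<Longrightarrow> K x y z w = - K x y w z"
    and bianchi: "\<And>x y z w. x \<in> S \<Longrightarrow> y \<in> S \<Longrightarrow> z \<in> S \<Longrightarrow> w \<in> S \<Longrightarrow>
      K x y z w + K y z x w + K z x y w = 0"
    and "x \<in> S" "y \<in> S" "z \<in> S" "w \<in> S"
  shows "K x y z w = K z w x y"
proof -
  note V = assms(4-)
  have "K x y z w + K y z x w + K z x y w = 0"
    using bianchi[of x y z w] V by simp
  moreover have "K y z x w + K z w x y + K y w z x = 0"
    using bianchi[of y z w x] skew'[of y z w x] skew'[of z w y x] skew[of w y z x] V by simp
  moreover have "K z w x y + K x w y z + K z x y w = 0"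
    using bianchi[of z w x y] skew'[of w x z y] skew[of w x y z] skew'[of x z w y] skew[of x z y w] V
    by simp
  moreover have "K x w y z + K x y z w + K y w z x = 0"
    using bianchi[of w x y z] skew[of w x y z] skew'[of x y w z] skew'[of y w x z] V by simp
  ultimately show ?thesis by linarith
qed

text \<open>Linearity of \<open>R\<close> is derived rather than assumed. In the third argument it
  comes from moving that argument into the metric slot, in the first from the pair symmetry, in the
  second from skewness; nondegeneracy turns each identity of scalars into one of vectors.\<close>

locale algebraic_curvature =
  fixes V :: "'v::real_vector set" and g :: "'v \<Rightarrow> 'v \<Rightarrow> real" and R :: "'v \<Rightarrow> 'v \<Rightarrow> 'v \<Rightarrow> 'v"
  assumes subspace: "subspace V"
    and sym: "u \<in> V \<Longrightarrow> v \<in> V \<Longrightarrow> g u v = g v u"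
    and add_left: "u \<in> V \<Longrightarrow> v \<in> V \<Longrightarrow> w \<in> V \<Longrightarrow> g (u + v) w = g u w + g v w"
    and scale_left: "u \<in> V \<Longrightarrow> v \<in> V \<Longrightarrow> g (c *\<^sub>R u) v = c * g u v"
    and nondegenerate: "u \<in> V \<Longrightarrow> (\<And>v. v \<in> V \<Longrightarrow> g u v = 0) \<Longrightarrow> u = 0"
    and closed: "u \<in> V \<Longrightarrow> v \<in> V \<Longrightarrow> w \<in> V \<Longrightarrow> R u v w \<in> V"
    and skew: "u \<in> V \<Longrightarrow> v \<in> V \<Longrightarrow> w \<in> V \<Longrightarrow> R u v w = - R v u w"
    and bianchi: "u \<in> V \<Longrightarrow> v \<in> V \<Longrightarrow> w \<in> V \<Longrightarrow> R u v w + R v w u + R w u v = 0"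
    and metric_skew: "u \<in> V \<Longrightarrow> v \<in> V \<Longrightarrow> w \<in> V \<Longrightarrow> z \<in> V \<Longrightarrow> g (R u v w) z = - g (R u v z) w"
begin

lemma mem [simp]:
  "0 \<in> V" "u \<in> V \<Longrightarrow> v \<in> V \<Longrightarrow> u + v \<in> V" "u \<in> V \<Longrightarrow> c *\<^sub>R u \<in> V"
  "u \<in> V \<Longrightarrow> v \<in> V \<Longrightarrow> u - v \<in> V" "u \<in> V \<Longrightarrow> - u \<in> V"
  using subspace by (auto simp: subspace_0 subspace_add subspace_scale subspace_diff subspace_neg)

lemma add_right: "u \<in> V \<Longrightarrow> v \<in> V \<Longrightarrow> w \<in> V \<Longrightarrow> g u (v + w) = g u v + g u w"
  by (simp add: sym[of u] add_left)

lemma scale_right: "u \<in> V \<Longrightarrow> v \<in> V \<Longrightarrow> g u (c *\<^sub>R v) = c * g u v"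
  by (simp add: sym[of u] scale_left)

lemma zero_left: "v \<in> V \<Longrightarrow> g 0 v = 0"
  using scale_left[of 0 v 0] by simp

lemma minus_left: "u \<in> V \<Longrightarrow> v \<in> V \<Longrightarrow> g (- u) v = - g u v"
  using scale_left[of u v "- 1"] by simp

lemma metric_ext:
  assumes "u \<in> V" "v \<in> V" "\<And>w. w \<in> V \<Longrightarrow> g u w = g v w"
  shows "u = v"
proof -
  have "u - v = 0"
    using assms add_left[of u "- v"] minus_left[of v] by (intro nondegenerate) auto
  then show ?thesis by simp
qed

lemma pair_symmetry:
  assumes "u \<in> V" "v \<in> V" "w \<in> V" "z \<in> V"
  shows "g (R u v w) z = g (R w z u) v"
proof (rule curvature_pair_symmetry[where K = "\<lambda>u v w z. g (R u v w) z", OF _ _ _ assms])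
  fix x y z w assume V: "x \<in> V" "y \<in> V" "z \<in> V" "w \<in> V"
  show "g (R x y z) w = - g (R y x z) w"
    using V skew[of x y z] minus_left closed by metis
  show "g (R x y z) w = - g (R x y w) z"
    using V by (rule metric_skew)
  have "g (R x y z) w + g (R y z x) w + g (R z x y) w = g (R x y z + R y z x + R z x y) w"
    using V by (simp add: add_left closed)
  then show "g (R x y z) w + g (R y z x) w + g (R z x y) w = 0"
    using V by (simp add: bianchi zero_left)
qed

lemma add3:
  assumes "u \<in> V" "v \<in> V" "w \<in> V" "w' \<in> V"
  shows "R u v (w + w') = R u v w + R u v w'"
proof (rule metric_ext)
  fix z assume z: "z \<in> V"
  have "g (R u v (w + w')) z = - g (R u v z) (w + w')"
    using assms z by (intro metric_skew) auto
  also have "\<dots> = g (R u v w) z + g (R u v w') z"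
    using assms z metric_skew[of u v z w] metric_skew[of u v z w'] by (simp add: add_right closed)
  finally show "g (R u v (w + w')) z = g (R u v w + R u v w') z"
    using assms z by (simp add: add_left closed)
qed (use assms closed in auto)

lemma scale3:
  assumes "u \<in> V" "v \<in> V" "w \<in> V"
  shows "R u v (c *\<^sub>R w) = c *\<^sub>R R u v w"
proof (rule metric_ext)
  fix z assume z: "z \<in> V"
  have "g (R u v (c *\<^sub>R w)) z = - g (R u v z) (c *\<^sub>R w)"
    using assms z by (intro metric_skew) auto
  also have "\<dots> = c * g (R u v w) z"
    using assms z metric_skew[of u v z w] by (simp add: scale_right closed)
  finally show "g (R u v (c *\<^sub>R w)) z = g (c *\<^sub>R R u v w) z"
    using assms z by (simp add: scale_left closed)
qed (use assms closed in auto)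

lemma add1:
  assumes "u \<in> V" "u' \<in> V" "v \<in> V" "w \<in> V"
  shows "R (u + u') v w = R u v w + R u' v w"
proof (rule metric_ext)
  fix z assume z: "z \<in> V"
  have "g (R (u + u') v w) z = g (R w z (u + u')) v"
    using assms z by (intro pair_symmetry) auto
  also have "\<dots> = g (R u v w) z + g (R u' v w) z"
    using assms z pair_symmetry[of u v w z] pair_symmetry[of u' v w z]
    by (simp add: add3 add_left closed)
  finally show "g (R (u + u') v w) z = g (R u v w + R u' v w) z"
    using assms z by (simp add: add_left closed)
qed (use assms closed in auto)

lemma scale1:
  assumes "u \<in> V" "v \<in> V" "w \<in> V"
  shows "R (c *\<^sub>R u) v w = c *\<^sub>R R u v w"
proof (rule metric_ext)
  fix z assume z: "z \<in> V"
  have "g (R (c *\<^sub>R u) v w) z = g (R w z (c *\<^sub>R u)) v"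
    using assms z by (intro pair_symmetry) auto
  also have "\<dots> = c * g (R u v w) z"
    using assms z pair_symmetry[of u v w z] by (simp add: scale3 scale_left closed)
  finally show "g (R (c *\<^sub>R u) v w) z = g (c *\<^sub>R R u v w) z"
    using assms z by (simp add: scale_left closed)
qed (use assms closed in auto)

lemma add2:
  assumes "u \<in> V" "v \<in> V" "v' \<in> V" "w \<in> V"
  shows "R u (v + v') w = R u v w + R u v' w"
  using assms skew[of u "v + v'" w] skew[of u v w] skew[of u v' w] by (simp add: add1)

lemma scale2:
  assumes "u \<in> V" "v \<in> V" "w \<in> V"
  shows "R u (c *\<^sub>R v) w = c *\<^sub>R R u v w"
  using assms skew[of u "c *\<^sub>R v" w] skew[of u v w] by (simp add: scale1)

lemma zero1: "v \<in> V \<Longrightarrow> w \<in> V \<Longrightarrow> R 0 v w = 0"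
  using scale1[of 0 v w 0] by simp

lemma alternating:
  assumes "u \<in> V" "w \<in> V"
  shows "R u u w = 0"
proof -
  have "2 *\<^sub>R R u u w = 0"
    using skew[of u u w] assms by (simp add: scaleR_2 eq_neg_iff_add_eq_0)
  then show ?thesis by simp
qed

lemma jacobi_add:
  assumes "u \<in> V" "v \<in> V" "a \<in> V"
  shows "R a (u + v) (u + v) = R a u u + R a v v + (R a u v + R a v u)"
  using assms by (simp add: add2 add3 algebra_simps)

lemma jacobi_self_adjoint:
  assumes "x \<in> V" "y \<in> V" "z \<in> V"
  shows "g (R y x x) z = g y (R z x x)"
proof -
  have "g (R y x x) z = g (R x z y) x" by (rule pair_symmetry) (use assms in auto)
  also have "\<dots> = - g (R x z x) y" by (rule metric_skew) (use assms in auto)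
  also have "\<dots> = g (R z x x) y" using assms skew[of x z x] by (simp add: minus_left closed)
  finally show ?thesis using assms by (simp add: sym[of y] closed)
qed

lemma jacobi_orthogonal: "x \<in> V \<Longrightarrow> y \<in> V \<Longrightarrow> g (R y x x) x = 0"
  using metric_skew[of y x x x] by simp

text \<open>Polarising J = 0 makes \<open>R\<close> skew in its last two arguments. Being skew in
  the first two as well, it is invariant under cyclic permutations, and the Bianchi sum is three
  times \<open>R u v w\<close>.\<close>

lemma jacobi_zero_imp_zero:
  assumes zero: "\<And>x y. x \<in> V \<Longrightarrow> y \<in> V \<Longrightarrow> R y x x = 0"
    and V: "u \<in> V" "v \<in> V" "w \<in> V"
  shows "R u v w = 0"
proof -
  have swap: "R a b c = - R a c b" if "a \<in> V" "b \<in> V" "c \<in> V" for a b c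
    using jacobi_add[of b c a] zero that by (simp add: eq_neg_iff_add_eq_0)
  have "R v w u = R u v w"
    using swap[of v w u] skew[of v u w] V by simp
  moreover have "R w u v = R u v w"
    using skew[of w u v] swap[of u w v] V by simp
  ultimately have "(1 + 1 + 1 :: real) *\<^sub>R R u v w = 0"
    using bianchi[OF V] by (simp only: scaleR_add_left scaleR_one)
  then show ?thesis by simp
qed

end

section \<open>Consequences of commuting Jacobi operators\<close>

locale jacobi_tsankov_curvature = algebraic_curvature +
  assumes jacobi_commute:
    "x \<in> V \<Longrightarrow> y \<in> V \<Longrightarrow> z \<in> V \<Longrightarrow> R (R z y y) x x = R (R z x x) y y"
begin

lemma jacobi_square_zero:
  assumes V: "y \<in> V" "z \<in> V"
  shows "R (R z y y) y y = 0"
proof -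
  have twisted: "R (R x y y) x x = 0" if "x \<in> V" for x
    using that V jacobi_commute[of x y x] by (simp add: alternating zero1)
  define a where "a = R z y y"
  have a: "a \<in> V" unfolding a_def using V closed by blast
  \<comment> \<open>Put \<open>y + c *\<^sub>R z\<close> for \<open>x\<close> in
    \<open>twisted\<close>. Since J(y) y = 0, the inner operator gives \<open>c *\<^sub>R a\<close>;
    the cubic term is a multiple of J(z) a, which vanishes by \<open>twisted\<close> once
    more.\<close>
  have polar: "c *\<^sub>R R a y y + (c * c) *\<^sub>R (R a y z + R a z y) = 0" for c
  proof -
    have "R (R (y + c *\<^sub>R z) y y) (y + c *\<^sub>R z) (y + c *\<^sub>R z) = 0"
      using V by (intro twisted) auto
    moreover have "R (y + c *\<^sub>R z) y y = c *\<^sub>R a"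
      unfolding a_def using V by (simp add: add1 scale1 alternating)
    moreover have "R a z z = 0"
      unfolding a_def using V twisted by blast
    ultimately show ?thesis
      using V a by (simp add: scale1 jacobi_add scale2 scale3 scaleR_add_right)
  qed
  \<comment> \<open>The values \<open>c = 1\<close> and \<open>c = - 1\<close> separate the odd part
    in \<open>c\<close>, which is J(y) a = J(y) (J(y) z).\<close>
  have "2 *\<^sub>R R a y y = (1 *\<^sub>R R a y y + (1 * 1) *\<^sub>R (R a y z + R a z y))
      - ((- 1) *\<^sub>R R a y y + ((- 1) * (- 1)) *\<^sub>R (R a y z + R a z y))"
    by (simp add: scaleR_2)
  also have "\<dots> = 0" unfolding polar by simp
  finally have "R a y y = 0" by simp
  then show ?thesis unfolding a_def .
qed

text \<open>Definiteness is asked only on the orthogonal complement of the given \<open>x\<close>.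
  In this form the lemma covers a definite metric and also a timelike vector of a Lorentzian
  one.\<close>

lemma jacobi_zero_if_orthogonal_definite:
  assumes V: "x \<in> V" "y \<in> V"
    and definite: "\<And>v. v \<in> V \<Longrightarrow> g v x = 0 \<Longrightarrow> g v v = 0 \<Longrightarrow> v = 0"
  shows "R y x x = 0"
proof (rule definite)
  show "R y x x \<in> V" "g (R y x x) x = 0"
    using V closed jacobi_orthogonal by auto
  show "g (R y x x) (R y x x) = 0"
    using V closed jacobi_self_adjoint[of x "R y x x" y] jacobi_square_zero[of x y]
    by (simp add: zero_left)
qed

text \<open>For small positive \<open>s\<close> the vector \<open>t + s *\<^sub>R x\<close> stays
  timelike, so its Jacobi operator vanishes. As J(t) = 0 too, a factor \<open>s\<close> can be
  cancelled, which leaves \<open>s\<close> times J(x) y plus a term free of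
  \<open>s\<close>.\<close>

lemma jacobi_zero_if_timelike_definite:
  assumes t: "t \<in> V" "g t t < 0"
    and definite: "\<And>x v. x \<in> V \<Longrightarrow> v \<in> V \<Longrightarrow> g x x < 0 \<Longrightarrow> g v x = 0 \<Longrightarrow> g v v = 0 \<Longrightarrow> v = 0"
    and V: "x \<in> V" "y \<in> V"
  shows "R y x x = 0"
proof -
  have timelike: "R y u u = 0" if "u \<in> V" "g u u < 0" for u
    using that V(2) definite[OF that(1) _ that(2)] by (intro jacobi_zero_if_orthogonal_definite)
  have "((\<lambda>s. g t t + 2 * s * g t x + s\<^sup>2 * g x x) \<longlongrightarrow> g t t) (at_right 0)"
    by (auto intro!: tendsto_eq_intros)
  then have "\<forall>\<^sub>F s in at_right 0. g t t + 2 * s * g t x + s\<^sup>2 * g x x < 0"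
    using t(2) by (rule order_tendstoD)
  then obtain d where d: "d > 0" "\<And>s. 0 < s \<Longrightarrow> s < d \<Longrightarrow> g t t + 2 * s * g t x + s\<^sup>2 * g x x < 0"
    unfolding eventually_at_right_field by auto
  have polar: "s *\<^sub>R R y x x + (R y t x + R y x t) = 0" if "0 < s" "s < d" for s
  proof -
    have "g (t + s *\<^sub>R x) (t + s *\<^sub>R x) = g t t + 2 * s * g t x + s\<^sup>2 * g x x"
      using t V by (simp add: add_left add_right scale_left scale_right sym[of x t]
          power2_eq_square algebra_simps)
    then have "R y (t + s *\<^sub>R x) (t + s *\<^sub>R x) = 0"
      using t V d(2)[OF that] by (intro timelike) auto
    moreover have "R y (t + s *\<^sub>R x) (t + s *\<^sub>R x) = s *\<^sub>R (s *\<^sub>R R y x x + (R y t x + R y x t))"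
      using t V timelike[OF t]
      by (simp add: jacobi_add scale2 scale3 scaleR_add_right)
    ultimately show ?thesis using that by simp
  qed
  \<comment> \<open>Any two distinct parameters in the interval eliminate the mixed term.\<close>
  have "(d / 2) *\<^sub>R R y x x = (d / 3) *\<^sub>R R y x x"
    using polar[of "d / 2"] polar[of "d / 3"] d(1) by (simp add: add_eq_0_iff2)
  then show ?thesis using d(1) by simp
qed

end

section \<open>The curvature of the Levi-Civita connection\<close>

lemma affine_connectionD:
  assumes "affine_connection A D" "X \<in> vector_fields A" "Y \<in> vector_fields A"
  shows "D X Y \<in> vector_fields A"
    and "Z \<in> vector_fields A \<Longrightarrow> D (X + Y) Z = D X Z + D Y Z"
    and "Z \<in> vector_fields A \<Longrightarrow> D X (Y + Z) = D X Y + D X Z"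
  using assms unfolding affine_connection_def by blast+

lemma affine_connection_diff:
  assumes "smooth_atlas A" "affine_connection A D"
    and "X \<in> vector_fields A" "Y \<in> vector_fields A" "Z \<in> vector_fields A"
  shows "D (X - Y) Z = D X Z - D Y Z" "D X (Y - Z) = D X Y - D X Z"
  using affine_connectionD(2)[OF assms(2) vector_fields_diff[OF assms(1,3,4)] assms(4,5)]
    affine_connectionD(3)[OF assms(2,3) vector_fields_diff[OF assms(1,4,5)] assms(5)]
  by (simp_all add: algebra_simps)

locale levi_civita =
  fixes A :: "('a::{t2_space, second_countable_topology}, 'e::euclidean_space) atlas"
    and g :: "'a metric_tensor"
    and D :: "'a connection"
    and p q :: nat
  assumes manifold: "pseudo_riemannian_manifold A g p q"
    and connection: "levi_civita_connection A g D"
begin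

abbreviation "VF \<equiv> vector_fields A"
abbreviation "G \<equiv> metric_on_fields g"
abbreviation "Rm \<equiv> curvature_field D"

lemma atlas: "smooth_atlas A"
  using manifold unfolding pseudo_riemannian_manifold_def by blast

lemma metric: "pseudo_riemannian_metric A g"
  using manifold unfolding pseudo_riemannian_manifold_def by blast

lemma affine: "affine_connection A D"
  using connection unfolding levi_civita_connection_def by blast

lemma torsion_free: "X \<in> VF \<Longrightarrow> Y \<in> VF \<Longrightarrow> lie_bracket X Y = D X Y - D Y X"
  using connection unfolding levi_civita_connection_def by simp

lemma metric_compatible:
  "X \<in> VF \<Longrightarrow> Y \<in> VF \<Longrightarrow> Z \<in> VF \<Longrightarrow> X (G Y Z) = G (D X Y) Z + G Y (D X Z)"
  using connection unfolding levi_civita_connection_def by blast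

lemma D_closed: "X \<in> VF \<Longrightarrow> Y \<in> VF \<Longrightarrow> D X Y \<in> VF"
  by (rule affine_connectionD(1)[OF affine])

lemmas VF_diff = vector_fields_diff[OF atlas]
lemmas VF_add = vector_fields_add[OF atlas]
lemmas D_diff = affine_connection_diff[OF atlas affine]

lemma lie_closed: "X \<in> VF \<Longrightarrow> Y \<in> VF \<Longrightarrow> lie_bracket X Y \<in> VF"
  by (simp add: torsion_free VF_diff D_closed)

lemma Rm_closed: "X \<in> VF \<Longrightarrow> Y \<in> VF \<Longrightarrow> Z \<in> VF \<Longrightarrow> Rm X Y Z \<in> VF"
  by (simp add: curvature_field_def VF_diff D_closed lie_closed)

lemma metricD:
  assumes "u \<in> tangent_space A x" "v \<in> tangent_space A x"
  shows "g x u v = g x v u"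
    and "w \<in> tangent_space A x \<Longrightarrow> g x (u + v) w = g x u w + g x v w"
    and "g x (c *\<^sub>R u) v = c * g x u v"
  using metric assms unfolding pseudo_riemannian_metric_def by blast+

lemma metric_nondegenerate:
  "u \<in> tangent_space A x \<Longrightarrow> (\<And>v. v \<in> tangent_space A x \<Longrightarrow> g x u v = 0) \<Longrightarrow> u = 0"
  using metric unfolding pseudo_riemannian_metric_def by blast

lemma G_sym: "X \<in> VF \<Longrightarrow> Y \<in> VF \<Longrightarrow> G X Y = G Y X"
  unfolding metric_on_fields_def by (intro ext metricD(1) field_at_tangent)

lemma G_smooth: "X \<in> VF \<Longrightarrow> Y \<in> VF \<Longrightarrow> G X Y \<in> smooth_functions A"
  using metric unfolding pseudo_riemannian_metric_def by blast

lemma G_add: "X \<in> VF \<Longrightarrow> Y \<in> VF \<Longrightarrow> Z \<in> VF \<Longrightarrow> G (X + Y) Z = G X Z + G Y Z"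
  by (rule ext) (simp add: metric_on_fields_def field_at_linear metricD(2) field_at_tangent)

lemma G_diff: "X \<in> VF \<Longrightarrow> Y \<in> VF \<Longrightarrow> Z \<in> VF \<Longrightarrow> G (X - Y) Z = G X Z - G Y Z"
  using G_add[of "X - Y" Y Z] by (simp add: VF_diff algebra_simps)

lemma G_diff_right: "X \<in> VF \<Longrightarrow> Y \<in> VF \<Longrightarrow> Z \<in> VF \<Longrightarrow> G Z (X - Y) = G Z X - G Z Y"
  by (simp add: G_sym[of Z] G_diff VF_diff)

lemma Rm_skew:
  assumes "X \<in> VF" "Y \<in> VF" "Z \<in> VF"
  shows "Rm X Y Z = - Rm Y X Z"
  using assms by (simp add: curvature_field_def torsion_free D_diff D_closed)

lemma jacobi_identity:
  assumes "X \<in> VF" "Y \<in> VF" "Z \<in> VF"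
  shows "lie_bracket X (lie_bracket Y Z) + lie_bracket Y (lie_bracket Z X)
    + lie_bracket Z (lie_bracket X Y) = 0"
proof
  fix f
  show "(lie_bracket X (lie_bracket Y Z) + lie_bracket Y (lie_bracket Z X)
      + lie_bracket Z (lie_bracket X Y)) f = 0 f"
  proof (cases "f \<in> smooth_functions A")
    case True
    note smooth = assms[THEN vector_fieldsD(1)]
    show ?thesis
      unfolding plus_fun_apply lie_bracket_def
      by (simp only: assms[THEN vector_field_diff[OF atlas]] smooth True)
        (simp add: fun_eq_iff)
  next
    \<comment> \<open>Equality of derivations includes the default value 0 outside the smooth
      functions, which the iterated brackets share because they are vector fields again.\<close>
    case False
    have "L f = 0" if "L \<in> VF" for L
      using vector_fieldsD(5)[OF that False] .
    then have "lie_bracket X (lie_bracket Y Z) f = 0" "lie_bracket Y (lie_bracket Z X) f = 0"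
      "lie_bracket Z (lie_bracket X Y) f = 0"
      using assms lie_closed by blast+
    then show ?thesis by (auto simp: fun_eq_iff)
  qed
qed

text \<open>Without torsion, each double bracket expands into covariant derivatives. The nine terms
  of the cyclic sum are those of the three curvatures, regrouped, so the claim is the Jacobi
  identity.\<close>

lemma Rm_bianchi:
  assumes V: "X \<in> VF" "Y \<in> VF" "Z \<in> VF"
  shows "Rm X Y Z + Rm Y Z X + Rm Z X Y = 0"
proof -
  have lie: "lie_bracket U (lie_bracket W T)
      = D U (D W T) - D U (D T W) - D (lie_bracket W T) U"
    if "U \<in> VF" "W \<in> VF" "T \<in> VF" for U W T
    using that torsion_free[OF that(1) lie_closed[OF that(2,3)]]
    by (simp add: torsion_free D_diff D_closed)
  show ?thesis
    using jacobi_identity[OF V] V by (simp add: lie curvature_field_def algebra_simps)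
qed

text \<open>The operator XY - YX - [X,Y] annihilates the function \<open>G Z W\<close>. Expanding by
  metric compatibility, the mixed products of first derivatives are symmetric in the two directions
  and cancel, and the two curvature terms remain.\<close>

lemma Rm_metric_skew:
  assumes V: "X \<in> VF" "Y \<in> VF" "Z \<in> VF" "W \<in> VF"
  shows "G (Rm X Y Z) W = - G (Rm X Y W) Z"
proof -
  have second: "U (T (G Z W)) = G (D U (D T Z)) W + G (D T Z) (D U W)
      + (G (D U Z) (D T W) + G Z (D U (D T W)))" if "U \<in> VF" "T \<in> VF" for U T
  proof -
    have "T (G Z W) = G (D T Z) W + G Z (D T W)"
      by (intro metric_compatible that V)
    moreover have "U (G (D T Z) W + G Z (D T W)) = U (G (D T Z) W) + U (G Z (D T W))"
      by (intro vector_fieldsD(2)[OF that(1)] G_smooth D_closed that V)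
    moreover have "U (G (D T Z) W) = G (D U (D T Z)) W + G (D T Z) (D U W)"
      by (intro metric_compatible D_closed that V)
    moreover have "U (G Z (D T W)) = G (D U Z) (D T W) + G Z (D U (D T W))"
      by (intro metric_compatible D_closed that V)
    ultimately show ?thesis by simp
  qed
  have bracket: "lie_bracket X Y (G Z W) = G (D (lie_bracket X Y) Z) W + G Z (D (lie_bracket X Y) W)"
    by (intro metric_compatible lie_closed V)
  have left: "G (Rm X Y Z) W
      = G (D X (D Y Z)) W - G (D Y (D X Z)) W - G (D (lie_bracket X Y) Z) W"
    using V by (simp add: curvature_field_def G_diff D_closed lie_closed VF_diff)
  have right: "G Z (Rm X Y W)
      = G Z (D X (D Y W)) - G Z (D Y (D X W)) - G Z (D (lie_bracket X Y) W)"
    using V by (simp add: curvature_field_def G_diff_right D_closed lie_closed VF_diff)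
  have "G (Rm X Y Z) W + G Z (Rm X Y W)
      = X (Y (G Z W)) - Y (X (G Z W)) - lie_bracket X Y (G Z W)"
    unfolding left right second[OF V(1,2)] second[OF V(2,1)] bracket by (simp add: algebra_simps)
  also have "\<dots> = 0" by (simp add: lie_bracket_def)
  finally have "G (Rm X Y Z) W + G Z (Rm X Y W) = 0" .
  then show ?thesis
    using V by (simp add: G_sym[of Z] Rm_closed eq_neg_iff_add_eq_0)
qed

lemma Rm_pair_symmetry:
  assumes V: "X \<in> VF" "Y \<in> VF" "Z \<in> VF" "W \<in> VF"
  shows "G (Rm X Y Z) W x = G (Rm Z W X) Y x"
proof (rule curvature_pair_symmetry[where K = "\<lambda>X Y Z W. G (Rm X Y Z) W x", OF _ _ _ V])
  fix X Y Z W assume V: "X \<in> VF" "Y \<in> VF" "Z \<in> VF" "W \<in> VF"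
  have zero: "G 0 W = 0"
    using G_diff[OF vector_fields_zero vector_fields_zero V(4)] by simp
  have "G (Rm X Y Z) W + G (Rm Y X Z) W = G (Rm X Y Z + Rm Y X Z) W"
    using V by (simp only: G_add Rm_closed)
  also have "Rm X Y Z + Rm Y X Z = 0"
    by (subst Rm_skew[OF V(1-3)]) simp
  finally have "(G (Rm X Y Z) W + G (Rm Y X Z) W) x = (0 :: 'a \<Rightarrow> real) x"
    unfolding zero by (rule fun_cong)
  then show "G (Rm X Y Z) W x = - G (Rm Y X Z) W x" by simp
  show "G (Rm X Y Z) W x = - G (Rm X Y W) Z x"
    using fun_cong[OF Rm_metric_skew[OF V], of x] by simp
  have "G (Rm X Y Z) W + G (Rm Y Z X) W + G (Rm Z X Y) W = G (Rm X Y Z + Rm Y Z X + Rm Z X Y) W"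
    using V by (simp only: G_add Rm_closed VF_add)
  also have "Rm X Y Z + Rm Y Z X + Rm Z X Y = 0"
    by (rule Rm_bianchi[OF V(1-3)])
  finally have "(G (Rm X Y Z) W + G (Rm Y Z X) W + G (Rm Z X Y) W) x = (0 :: 'a \<Rightarrow> real) x"
    unfolding zero by (rule fun_cong)
  then show "G (Rm X Y Z) W x + G (Rm Y Z X) W x + G (Rm Z X Y) W x = 0" by simp
qed

section \<open>From vector fields to tangent vectors\<close>

lemma extend:
  assumes "u \<in> tangent_space A x"
  obtains X where "X \<in> VF" "field_at X x = u"
proof -
  obtain e where "indexed_basis (tangent_space A x) DIM('e) e"
    using manifold unfolding pseudo_riemannian_manifold_def has_signature_def by metis
  from field_at_surj[OF atlas this assms] that show ?thesis by blast
qed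

text \<open>By its symmetries the curvature may be written with any one of its arguments paired with the
  metric, hence depends only on the values of its arguments at the point.\<close>

lemma Rm_tensorial:
  assumes V: "X \<in> VF" "Y \<in> VF" "Z \<in> VF" "X' \<in> VF" "Y' \<in> VF" "Z' \<in> VF"
    and eq: "field_at X x = field_at X' x" "field_at Y x = field_at Y' x"
      "field_at Z x = field_at Z' x"
  shows "field_at (Rm X Y Z) x = field_at (Rm X' Y' Z') x"
proof -
  have G_cong: "G U S x = G U T x" if "field_at S x = field_at T x" for U S T
    using that by (simp add: metric_on_fields_def)
  have "G (Rm X Y Z) W x = G (Rm X' Y' Z') W x" if W: "W \<in> VF" for W
  proof -
    \<comment> \<open>One argument is exchanged at a time, while it sits in the metric slot, where
      only its value at \<open>x\<close> enters.\<close>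
    have "G (Rm X Y Z) W x = G (Rm X Y Z') W x"
      using V W G_cong[OF eq(3), of "Rm X Y W"] by (simp add: Rm_metric_skew[of _ _ _ W])
    also have "\<dots> = G (Rm X Y' Z') W x"
      using V W G_cong[OF eq(2), of "Rm Z' W X"] by (simp add: Rm_pair_symmetry[of _ _ _ W])
    also have "\<dots> = G (Rm X' Y' Z') W x"
      using V W G_cong[OF eq(1), of "Rm Z' W Y'"]
      by (simp add: Rm_pair_symmetry[of _ _ _ W] Rm_metric_skew[of Z' W _ Y'])
    finally show ?thesis .
  qed
  then have null: "g x (field_at (Rm X Y Z - Rm X' Y' Z') x) (field_at W x) = 0" if "W \<in> VF" for W
    using that V fun_cong[OF G_diff[of "Rm X Y Z" "Rm X' Y' Z'" W], of x] Rm_closed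
    by (simp add: metric_on_fields_def)
  have "field_at (Rm X Y Z - Rm X' Y' Z') x = 0"
  proof (rule metric_nondegenerate)
    show "field_at (Rm X Y Z - Rm X' Y' Z') x \<in> tangent_space A x"
      using V by (intro field_at_tangent VF_diff Rm_closed)
    fix v assume "v \<in> tangent_space A x"
    then obtain W where "W \<in> VF" "field_at W x = v" by (rule extend)
    with null show "g x (field_at (Rm X Y Z - Rm X' Y' Z') x) v = 0" by blast
  qed
  then show ?thesis by (simp add: field_at_linear)
qed

lemma curvature_field_at:
  assumes "X \<in> VF" "Y \<in> VF" "Z \<in> VF"
  shows "curvature A D x (field_at X x) (field_at Y x) (field_at Z x) = field_at (Rm X Y Z) x"
  unfolding curvature_def
proof (rule the_equality)
  fix r
  assume "\<exists>X'\<in>VF. \<exists>Y'\<in>VF. \<exists>Z'\<in>VF. field_at X' x = field_at X x \<and> field_at Y' x = field_at Y x \<and>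
    field_at Z' x = field_at Z x \<and> r = field_at (Rm X' Y' Z') x"
  then obtain X' Y' Z' where "X' \<in> VF" "Y' \<in> VF" "Z' \<in> VF"
    "field_at X' x = field_at X x" "field_at Y' x = field_at Y x" "field_at Z' x = field_at Z x"
    "r = field_at (Rm X' Y' Z') x" by blast
  then show "r = field_at (Rm X Y Z) x"
    using Rm_tensorial[of X' Y' Z' X Y Z x] assms by simp
qed (use assms in blast)

lemma algebraic_curvature_at: "algebraic_curvature (tangent_space A x) (g x) (curvature A D x)"
proof
  show "subspace (tangent_space A x)" by (rule subspace_tangent_space)
  show "u = 0" if "u \<in> tangent_space A x" "\<And>v. v \<in> tangent_space A x \<Longrightarrow> g x u v = 0" for u
    using that by (rule metric_nondegenerate)
next
  fix u v w assume u: "u \<in> tangent_space A x" and v: "v \<in> tangent_space A x"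
    and w: "w \<in> tangent_space A x"
  obtain X where X: "X \<in> VF" "u = field_at X x" using extend[OF u] by blast
  obtain Y where Y: "Y \<in> VF" "v = field_at Y x" using extend[OF v] by blast
  obtain Z where Z: "Z \<in> VF" "w = field_at Z x" using extend[OF w] by blast
  have R: "curvature A D x (field_at X x) (field_at Y x) (field_at Z x) = field_at (Rm X Y Z) x"
    if "X \<in> VF" "Y \<in> VF" "Z \<in> VF" for X Y Z
    by (rule curvature_field_at[OF that])
  show "curvature A D x u v w \<in> tangent_space A x"
    unfolding X(2) Y(2) Z(2) using X Y Z by (simp only: R field_at_tangent Rm_closed)
  show "curvature A D x u v w = - curvature A D x v u w"
    unfolding X(2) Y(2) Z(2) using X Y Z
    by (simp only: R Rm_skew[of X Y Z]) (simp add: field_at_def fun_eq_iff)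
  show "curvature A D x u v w + curvature A D x v w u + curvature A D x w u v = 0"
    unfolding X(2) Y(2) Z(2) using X Y Z
    by (simp only: R Rm_bianchi field_at_linear(4) flip: field_at_linear(1))
  fix z assume z: "z \<in> tangent_space A x"
  obtain W where W: "W \<in> VF" "z = field_at W x" using extend[OF z] by blast
  show "g x (curvature A D x u v w) z = - g x (curvature A D x u v z) w"
    unfolding X(2) Y(2) Z(2) W(2)
    using X Y Z W fun_cong[OF Rm_metric_skew[of X Y Z W], of x]
    by (simp add: R metric_on_fields_def)
qed (rule metricD; assumption)+

end

section \<open>Nilpotent operators and the signature\<close>

lemma square_zero_eigenvalue:
  fixes M :: "'a::field mat"
  assumes M: "M \<in> carrier_mat n n" "M * M = 0\<^sub>m n n" and "eigenvalue M k"
  shows "k = 0"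
proof -
  obtain v where v: "v \<in> carrier_vec n" "v \<noteq> 0\<^sub>v n" "M *\<^sub>v v = k \<cdot>\<^sub>v v"
    using assms(3) M(1) unfolding eigenvalue_def eigenvector_def by auto
  obtain i where i: "i < n" "v $ i \<noteq> 0"
    using v(1,2) by (metis carrier_vecD eq_vecI index_zero_vec)
  have "0\<^sub>m n n *\<^sub>v v = M *\<^sub>v (M *\<^sub>v v)"
    using assoc_mult_mat_vec[OF M(1) M(1) v(1)] M(2) by simp
  also have "\<dots> = k \<cdot>\<^sub>v (k \<cdot>\<^sub>v v)"
    using v(3) mult_mat_vec[OF M(1) v(1)] by simp
  finally have "(0\<^sub>m n n *\<^sub>v v) $ i = (k \<cdot>\<^sub>v (k \<cdot>\<^sub>v v)) $ i" by simp
  with i v(1) show ?thesis by simp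
qed

text \<open>Over the complex numbers the polynomial splits into \<open>n\<close> linear factors, and
  every root is an eigenvalue, hence 0. The result descends because the embedding of the reals is
  injective on coefficients.\<close>

lemma char_poly_square_zero:
  fixes M :: "real mat"
  assumes M: "M \<in> carrier_mat n n" "M * M = 0\<^sub>m n n"
  shows "char_poly M = [:0, 1:] ^ n"
proof -
  let ?C = "map_mat complex_of_real M"
  have C: "?C \<in> carrier_mat n n" using M(1) by simp
  have "?C * ?C = map_mat complex_of_real (M * M)"
    using of_real_hom.mat_hom_mult[OF M(1) M(1)] by metis
  also have "\<dots> = 0\<^sub>m n n" using M(2) by auto
  finally have C2: "?C * ?C = 0\<^sub>m n n" .
  obtain as where as: "char_poly ?C = (\<Prod>a\<leftarrow>as. [:- a, 1:])" "length as = n"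
    using char_poly_factorized[OF C] by blast
  have "a = 0" if "a \<in> set as" for a
  proof (rule square_zero_eigenvalue[OF C C2])
    show "eigenvalue ?C a"
      unfolding eigenvalue_root_char_poly[OF C] as(1) poly_prod_list
      using that by (force simp: prod_list_zero_iff)
  qed
  then have "as = replicate n 0"
    using as(2) by (metis replicate_length_same)
  then have "char_poly ?C = [:0, 1:] ^ n"
    using as(1) by (simp add: prod_list_replicate)
  then have "map_poly complex_of_real (char_poly M) = [:0, 1:] ^ n"
    unfolding of_real_hom.char_poly_hom[OF M(1)] .
  also have "\<dots> = map_poly complex_of_real ([:0, 1:] ^ n)"
    using monom_altdef[of "1 :: real" n] monom_altdef[of "1 :: complex" n]
      map_poly_monom[of complex_of_real 1 n] by simp
  finally show ?thesis
    by (simp add: poly_eq_iff coeff_map_poly)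
qed

text \<open>Linearity is required on \<open>V\<close> only, since the curvature is unspecified on
  arguments that are not tangent vectors.\<close>

lemma linear_on_sum:
  fixes f :: "'v::real_vector \<Rightarrow> 'w::real_vector"
  assumes V: "subspace V"
    and add: "\<And>u v. u \<in> V \<Longrightarrow> v \<in> V \<Longrightarrow> f (u + v) = f u + f v"
    and scale: "\<And>c v. v \<in> V \<Longrightarrow> f (c *\<^sub>R v) = c *\<^sub>R f v"
    and e: "\<And>i. i \<in> I \<Longrightarrow> e i \<in> V"
  shows "f (\<Sum>i\<in>I. c i *\<^sub>R e i) = (\<Sum>i\<in>I. c i *\<^sub>R f (e i))"
proof -
  have zero: "f 0 = 0"
    using scale[of 0 0] subspace_0[OF V] by simp
  show ?thesis
    using e
  proof (induction I rule: infinite_finite_induct)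
    case (insert i I)
    then show ?case
      using V by (simp add: add scale subspace_sum subspace_scale)
  qed (simp_all add: zero)
qed

lemma indexed_basis_mem: "indexed_basis V n e \<Longrightarrow> i < n \<Longrightarrow> e i \<in> V"
  unfolding indexed_basis_def by (auto intro: span_base)

lemma indexed_basis_expand:
  assumes "indexed_basis V n e" "v \<in> V"
  obtains c where "v = (\<Sum>i<n. c i *\<^sub>R e i)"
proof -
  have "v \<in> range (\<lambda>u. \<Sum>w\<in>e ` {..<n}. u w *\<^sub>R w)"
    using assms span_finite[of "e ` {..<n}"] unfolding indexed_basis_def by simp
  then obtain u where "v = (\<Sum>w\<in>e ` {..<n}. u w *\<^sub>R w)" by blast
  also have "\<dots> = (\<Sum>i<n. u (e i) *\<^sub>R e i)"
    using assms(1) unfolding indexed_basis_def by (subst sum.reindex) auto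
  finally show ?thesis by (rule that)
qed

lemma indexed_basis_coeff_zero:
  assumes e: "indexed_basis V n e" and zero: "(\<Sum>i<n. c i *\<^sub>R e i) = 0" and "j < n"
  shows "c j = 0"
proof -
  have inj: "inj_on e {..<n}" using e unfolding indexed_basis_def by blast
  let ?u = "\<lambda>w. c (inv_into {..<n} e w)"
  have "(\<Sum>w\<in>e ` {..<n}. ?u w *\<^sub>R w) = (\<Sum>i<n. c i *\<^sub>R e i)"
    using inj by (subst sum.reindex) (auto intro!: sum.cong)
  then have "?u (e j) = 0"
    using e zero \<open>j < n\<close> unfolding indexed_basis_def
    by (intro independentD[of "e ` {..<n}" "e ` {..<n}" ?u]) auto
  then show ?thesis using inj \<open>j < n\<close> by simp
qed

lemma indexed_basis_unique_card:
  assumes "indexed_basis V n e" "indexed_basis V m e'"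
  shows "n = m"
proof -
  have le: "n \<le> m" if "indexed_basis V n e" "indexed_basis V m e'" for n m e e'
  proof -
    have "card (e ` {..<n}) \<le> card (e' ` {..<m})"
    proof -
      have "independent (e ` {..<n})" "e ` {..<n} \<subseteq> span (e' ` {..<m})"
        using that span_superset[of "e ` {..<n}"] unfolding indexed_basis_def by auto
      from independent_span_bound[OF _ this] show ?thesis by blast
    qed
    with that show ?thesis
      unfolding indexed_basis_def by (simp add: card_image)
  qed
  show ?thesis using le assms by (intro antisym)
qed

text \<open>In every basis the matrix of \<open>T\<close> squares to zero, so each candidate of the
  definite description is a power of the variable. The candidates agree once all bases of
  \<open>V\<close> are known to have the same length.\<close>

lemma operator_char_poly_square_zero:
  fixes T :: "'v::real_vector \<Rightarrow> 'v"
  assumes V: "subspace V" and e: "indexed_basis V n e"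
    and closed: "\<And>v. v \<in> V \<Longrightarrow> T v \<in> V"
    and add: "\<And>u v. u \<in> V \<Longrightarrow> v \<in> V \<Longrightarrow> T (u + v) = T u + T v"
    and scale: "\<And>c v. v \<in> V \<Longrightarrow> T (c *\<^sub>R v) = c *\<^sub>R T v"
    and square: "\<And>v. v \<in> V \<Longrightarrow> T (T v) = 0"
  shows "operator_char_poly V T = [:0, 1:] ^ n"
  unfolding operator_char_poly_def
proof (rule the_equality)
  have char_poly: "char_poly M = [:0, 1:] ^ n'"
    if e': "indexed_basis V n' e'" and M: "operator_matrix T n' e' M" for n' e' M
  proof (rule char_poly_square_zero)
    show carrier: "M \<in> carrier_mat n' n'"
      using M unfolding operator_matrix_def by blast
    have Te: "T (e' j) = (\<Sum>i<n'. M $$ (i, j) *\<^sub>R e' i)" if "j < n'" for j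
      using M that unfolding operator_matrix_def by blast
    show "M * M = 0\<^sub>m n' n'"
    proof (rule eq_matI)
      fix k j assume "k < dim_row (0\<^sub>m n' n' :: real mat)" "j < dim_col (0\<^sub>m n' n' :: real mat)"
      then have k: "k < n'" and j: "j < n'" by auto
      have "0 = T (\<Sum>i<n'. M $$ (i, j) *\<^sub>R e' i)"
        using square[OF indexed_basis_mem[OF e' j]] Te[OF j] by simp
      also have "\<dots> = (\<Sum>i<n'. M $$ (i, j) *\<^sub>R T (e' i))"
        by (rule linear_on_sum[OF V add scale]) (auto intro: indexed_basis_mem[OF e'])
      also have "\<dots> = (\<Sum>i<n'. \<Sum>k<n'. (M $$ (k, i) * M $$ (i, j)) *\<^sub>R e' k)"
        by (intro sum.cong) (auto simp: Te scaleR_sum_right mult.commute)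
      also have "\<dots> = (\<Sum>k<n'. (\<Sum>i<n'. M $$ (k, i) * M $$ (i, j)) *\<^sub>R e' k)"
        by (subst sum.swap) (simp add: scaleR_sum_left)
      finally have "(\<Sum>k<n'. (\<Sum>i<n'. M $$ (k, i) * M $$ (i, j)) *\<^sub>R e' k) = 0"
        by (rule sym)
      from indexed_basis_coeff_zero[OF e' this k] show "(M * M) $$ (k, j) = 0\<^sub>m n' n' $$ (k, j)"
        using carrier k j by (simp add: scalar_prod_def lessThan_atLeast0)
    qed (use carrier in auto)
  qed
  have "\<exists>c. T (e j) = (\<Sum>i<n. c i *\<^sub>R e i)" if "j < n" for j
    using indexed_basis_expand[OF e closed[OF indexed_basis_mem[OF e that]]] by blast
  then obtain c where c: "\<And>j. j < n \<Longrightarrow> T (e j) = (\<Sum>i<n. c j i *\<^sub>R e i)" by metis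
  have M: "operator_matrix T n e (mat n n (\<lambda>(i, j). c j i))"
    unfolding operator_matrix_def using c by simp
  show "\<exists>n' e' M. indexed_basis V n' e' \<and> operator_matrix T n' e' M \<and> [:0, 1:] ^ n = char_poly M"
    by (intro exI conjI) (rule e, rule M, rule char_poly[OF e M, symmetric])
  fix c' assume "\<exists>n' e' M. indexed_basis V n' e' \<and> operator_matrix T n' e' M \<and> c' = char_poly M"
  then obtain n' e' M where e': "indexed_basis V n' e'" and "operator_matrix T n' e' M"
    and "c' = char_poly M" by blast
  with char_poly indexed_basis_unique_card[OF e e'] show "c' = [:0, 1:] ^ n" by simp
qed

text \<open>Here \<open>a\<close> and \<open>b\<close> are the time coordinates of a timelike vector
  and of a null vector orthogonal to it. Cauchy-Schwarz on the spatial parts bounds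
  \<open>a\<^sup>2 * b\<^sup>2\<close> by a strictly smaller multiple of \<open>b\<^sup>2\<close>
  unless \<open>b = 0\<close>.\<close>

lemma lorentz_null_orthogonal:
  fixes a b :: real and x v :: "'i \<Rightarrow> real"
  assumes "(\<Sum>i\<in>I. (x i)\<^sup>2) < a\<^sup>2" "(\<Sum>i\<in>I. x i * v i) = a * b" "(\<Sum>i\<in>I. (v i)\<^sup>2) = b\<^sup>2"
  shows "b = 0"
proof (rule ccontr)
  assume "b \<noteq> 0"
  have "a\<^sup>2 * b\<^sup>2 \<le> (\<Sum>i\<in>I. (x i)\<^sup>2) * b\<^sup>2"
    using Cauchy_Schwarz_ineq_sum[of x v I] assms(2,3) by (simp add: power_mult_distrib)
  with \<open>b \<noteq> 0\<close> assms(1) show False by simp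
qed

section \<open>Null vectors in the Riemannian and Lorentzian signatures\<close>

context algebraic_curvature
begin

context
  fixes p n :: nat and e :: "nat \<Rightarrow> 'v"
  assumes e: "indexed_basis V n e"
    and orthonormal: "\<And>i j. i < n \<Longrightarrow> j < n \<Longrightarrow>
      g (e i) (e j) = (if i \<noteq> j then 0 else if i < p then - 1 else 1)"
begin

lemma metric_coordinates:
  "g (\<Sum>i<n. c i *\<^sub>R e i) (\<Sum>i<n. d i *\<^sub>R e i) = (\<Sum>i<n. (if i < p then - 1 else 1) * (c i * d i))"
proof -
  have e_mem: "e i \<in> V" if "i \<in> {..<n}" for i
    using that indexed_basis_mem[OF e] by simp
  have sum_mem: "(\<Sum>i<n. d i *\<^sub>R e i) \<in> V"
    using e_mem by (intro subspace_sum[OF subspace]) simp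
  have "g (\<Sum>i<n. c i *\<^sub>R e i) (\<Sum>j<n. d j *\<^sub>R e j) = (\<Sum>i<n. c i *\<^sub>R g (e i) (\<Sum>j<n. d j *\<^sub>R e j))"
    by (rule linear_on_sum[OF subspace, where f = "\<lambda>u. g u (\<Sum>j<n. d j *\<^sub>R e j)"])
      (use sum_mem e_mem in \<open>auto simp: add_left scale_left\<close>)
  also have "\<dots> = (\<Sum>i<n. (if i < p then - 1 else 1) * (c i * d i))"
  proof (rule sum.cong[OF refl])
    fix i assume i: "i \<in> {..<n}"
    have "g (e i) (\<Sum>j<n. d j *\<^sub>R e j) = (\<Sum>j<n. d j *\<^sub>R g (e i) (e j))"
      by (rule linear_on_sum[OF subspace]) (use e_mem i in \<open>auto simp: add_right scale_right\<close>)
    also have "\<dots> = (\<Sum>j<n. if j = i then (if i < p then - 1 else 1) * d i else 0)"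
      using i by (intro sum.cong) (auto simp: orthonormal)
    also have "\<dots> = (if i < p then - 1 else 1) * d i"
      using i by (simp add: sum.delta)
    finally show "c i *\<^sub>R g (e i) (\<Sum>j<n. d j *\<^sub>R e j) = (if i < p then - 1 else 1) * (c i * d i)"
      by simp
  qed
  finally show ?thesis .
qed

lemma riemannian_definite:
  assumes "p = 0" "v \<in> V" "g v v = 0"
  shows "v = 0"
proof -
  obtain c where c: "v = (\<Sum>i<n. c i *\<^sub>R e i)" using indexed_basis_expand[OF e assms(2)] by blast
  have "(\<Sum>i<n. c i * c i) = 0"
    using assms(1,3) metric_coordinates[of c c] unfolding c by simp
  then have "c i = 0" if "i < n" for i
    using that by (simp add: sum_nonneg_eq_0_iff)
  then show ?thesis unfolding c by simp
qed

lemma lorentzian_definite: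
  assumes "p = 1" "0 < n" "x \<in> V" "v \<in> V" and gx: "g x x < 0" "g v x = 0" "g v v = 0"
  shows "v = 0"
proof -
  obtain a where a: "x = (\<Sum>i<n. a i *\<^sub>R e i)" using indexed_basis_expand[OF e assms(3)] by blast
  obtain c where c: "v = (\<Sum>i<n. c i *\<^sub>R e i)" using indexed_basis_expand[OF e assms(4)] by blast
  have coords: "g (\<Sum>i<n. c i *\<^sub>R e i) (\<Sum>i<n. d i *\<^sub>R e i) = - (c 0 * d 0) + (\<Sum>i\<in>{1..<n}. c i * d i)"
    for c d
  proof -
    have "(\<Sum>i<n. (if i < p then - 1 else 1) * (c i * d i)) =
        (\<Sum>i\<in>{0..<n}. (if i < p then - 1 else 1) * (c i * d i))"
      by (simp add: lessThan_atLeast0)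
    also have "\<dots> = - (c 0 * d 0) + (\<Sum>i\<in>{1..<n}. (if i < p then - 1 else 1) * (c i * d i))"
      using assms(1,2) by (subst sum.atLeast_Suc_lessThan) auto
    also have "(\<Sum>i\<in>{1..<n}. (if i < p then - 1 else 1) * (c i * d i)) = (\<Sum>i\<in>{1..<n}. c i * d i)"
      using assms(1) by (intro sum.cong) auto
    finally show ?thesis by (simp only: metric_coordinates)
  qed
  have null: "(\<Sum>i\<in>{1..<n}. (c i)\<^sup>2) = (c 0)\<^sup>2"
    using gx(3) coords[of c c] unfolding c by (simp add: power2_eq_square)
  \<comment> \<open>Once the time coordinate vanishes, \<open>null\<close> says that the spatial
    squares sum to 0.\<close>
  have "c 0 = 0"
  proof (rule lorentz_null_orthogonal[OF _ _ null])
    show "(\<Sum>i\<in>{1..<n}. (a i)\<^sup>2) < (a 0)\<^sup>2"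
      using gx(1) coords[of a a] unfolding a by (simp add: power2_eq_square)
    show "(\<Sum>i\<in>{1..<n}. a i * c i) = a 0 * c 0"
      using gx(2) coords[of c a] unfolding a c by (simp add: mult.commute)
  qed
  with null have "c i = 0" if "i < n" for i
    using that by (cases "i = 0") (auto simp: sum_nonneg_eq_0_iff)
  then show ?thesis unfolding c by simp
qed

end

end

theorem corollary1p5:
  fixes A :: "('a::{t2_space, second_countable_topology}, 'e::euclidean_space) atlas"
    and g :: "'a metric_tensor"
    and nabla :: "'a connection"
    and p q :: nat
  assumes "pseudo_riemannian_manifold A g p q"
    and "p + q \<ge> 3"
    and "levi_civita_connection A g nabla"
    and "jacobi_tsankov A nabla"
  shows "nilpotent_osserman A g nabla \<and> (p = 0 \<or> p = 1 \<longrightarrow> flat A nabla)"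
proof -
  interpret levi_civita A g nabla p q
    using assms(1,3) by unfold_locales
  have model: "jacobi_tsankov_curvature (tangent_space A x) (g x) (curvature A nabla x)" for x
    using assms(4) algebraic_curvature_at[of x]
    by (auto simp: jacobi_tsankov_curvature_def jacobi_tsankov_curvature_axioms_def
        jacobi_tsankov_def jacobi_operator_def)
  have basis: "\<exists>e. indexed_basis (tangent_space A x) (p + q) e \<and> (\<forall>i<p + q. \<forall>j<p + q.
      g x (e i) (e j) = (if i \<noteq> j then 0 else if i < p then - 1 else 1))" for x
    using assms(1) unfolding pseudo_riemannian_manifold_def has_signature_def by blast
  have square: "jacobi_operator A nabla x u (jacobi_operator A nabla x u v) = 0"
    if "u \<in> tangent_space A x" "v \<in> tangent_space A x" for x u v
    using jacobi_tsankov_curvature.jacobi_square_zero[OF model that]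
    by (simp add: jacobi_operator_def)
  have char_poly: "operator_char_poly (tangent_space A x) (jacobi_operator A nabla x u)
      = [:0, 1:] ^ (p + q)" if u: "u \<in> tangent_space A x" for x u
  proof -
    interpret jacobi_tsankov_curvature "tangent_space A x" "g x" "curvature A nabla x"
      by (rule model)
    obtain e where e: "indexed_basis (tangent_space A x) (p + q) e" using basis by blast
    show ?thesis
      by (rule operator_char_poly_square_zero[OF subspace e])
        (use u square in \<open>auto simp: jacobi_operator_def closed add1 scale1\<close>)
  qed
  have "osserman A g nabla"
    \<comment> \<open>The eigenvalue multiset is that of the power \<open>p + q\<close> of the
      variable, whatever the point, the vector and the sign of its norm.\<close>
    unfolding osserman_def operator_eigenvalues_def using char_poly by auto
  moreover have "nilpotent_on (tangent_space A x) (jacobi_operator A nabla x u)"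
    if "u \<in> tangent_space A x" for x u
    unfolding nilpotent_on_def using square[OF that] by (intro exI[of _ 2]) (simp add: numeral_2_eq_2)
  ultimately have "nilpotent_osserman A g nabla"
    unfolding nilpotent_osserman_def by blast
  moreover have "flat A nabla" if "p = 0 \<or> p = 1"
    unfolding flat_def
  proof (intro allI ballI)
    fix x u v w
    assume V: "u \<in> tangent_space A x" "v \<in> tangent_space A x" "w \<in> tangent_space A x"
    interpret jacobi_tsankov_curvature "tangent_space A x" "g x" "curvature A nabla x"
      by (rule model)
    obtain e where e: "indexed_basis (tangent_space A x) (p + q) e"
      and orthonormal: "\<And>i j. i < p + q \<Longrightarrow> j < p + q \<Longrightarrow>
        g x (e i) (e j) = (if i \<noteq> j then 0 else if i < p then - 1 else 1)"
      using basis[of x] by blast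
    show "curvature A nabla x u v w = 0"
    proof (rule jacobi_zero_imp_zero[OF _ V])
      fix y z assume y: "y \<in> tangent_space A x" and z: "z \<in> tangent_space A x"
      from that show "curvature A nabla x z y y = 0"
      proof
        assume "p = 0"
        then show ?thesis
          using riemannian_definite[OF e orthonormal]
          by (intro jacobi_zero_if_orthogonal_definite[OF y z]) blast
      next
        assume p: "p = 1"
        then have n: "0 < p + q" by simp
        show ?thesis
        proof (rule jacobi_zero_if_timelike_definite[OF _ _ _ y z])
          \<comment> \<open>With \<open>p = 1\<close>, \<open>e 0\<close> is the one timelike vector
            of the orthonormal basis and starts the perturbation.\<close>
          show "e 0 \<in> tangent_space A x" by (rule indexed_basis_mem[OF e n])
          show "g x (e 0) (e 0) < 0" using orthonormal[OF n n] p by simp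
        qed (use lorentzian_definite[OF e orthonormal p n] in blast)
      qed
    qed
  qed
  ultimately show ?thesis by blast
qed

end
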